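(* Let $f:M^2\to\mathbb R^3$ be a smooth, closed, mean-convex embedding enclosing a bounded domain $\Omega$, and let $\lambda_1>0$ denote its largest principal curvature. For a continuous function $u$ on $M$, let $b_u(x):=f(x)-u(x)\nu(x)$. Then $$\frac13\int_M\frac1{E_1}\,d\mu-|\Omega|=\left|V\left[b_{\frac1{\lambda_1}}\right]\right|+\frac16\int_M\frac{|\mathring A|^2}{\lambda_1^2E_1}\,d\mu=-V\left[b_{\frac1{E_1}}\right]+\frac16\int_M\frac{|\mathring A|^2}{E_1^3}\,d\mu.$$
   Context: $\nu$ is the outward unit normal, $g$ the induced metric, and $d\mu$ the induced area measure. The second fundamental form is $A(X,Y)=\langle\overline\nabla_X\nu,Y\rangle$, with principal curvatures $\lambda_1\ge\lambda_2$ at each point. $E_1=\frac12(\lambda_1+\lambda_2)$, mean-convex means $E_1>0$ everywhere, and $\mathring A=A-E_1g$. For continuous $w:M\to\mathbb R$, the oriented volume of the normal graph $\mathrm f=f+w\nu$ is $V[\mathrm f]:=|\Omega|+\int_M\int_0^{w(x)}(1+\lambda_1(x)t)(1+\lambda_2(x)t)\,dt\,d\mu(x)$, where the integrand is the signed Jacobian of $(x,t)\mapsto f(x)+t\nu(x)$. So $V[b_u]$ is obtained with $w=-u$. *)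

theory Defs
  imports "HOL-Analysis.Analysis"
begin

section \<open>Smooth maps between Euclidean spaces\<close>

text \<open>\<open>Ck_on k S f\<close> is meant for open \<open>S\<close> in a finite-dimensional space, where continuity of all
  iterated directional derivatives up to order \<open>k\<close> is the usual \<open>C\<^sup>k\<close> condition.\<close>

fun Ck_on :: "nat \<Rightarrow> 'a::real_normed_vector set \<Rightarrow> ('a \<Rightarrow> 'b::real_normed_vector) \<Rightarrow> bool" where
  "Ck_on 0 S f \<longleftrightarrow> continuous_on S f"
| "Ck_on (Suc k) S f \<longleftrightarrow>
     (\<forall>x\<in>S. f differentiable (at x)) \<and> (\<forall>v. Ck_on k S (\<lambda>x. frechet_derivative f (at x) v))"

definition smooth_on :: "'a::real_normed_vector set \<Rightarrow> ('a \<Rightarrow> 'b::real_normed_vector) \<Rightarrow> bool" where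
  "smooth_on S f \<longleftrightarrow> (\<forall>k. Ck_on k S f)"


section \<open>Smooth surfaces and embeddings into space\<close>

text \<open>A surface is a topological space (the type \<open>'m\<close>) with an atlas of local parametrizations,
  that is, of inverse charts \<open>\<phi> : U \<rightarrow> M\<close>, represented as pairs \<open>(U, \<phi>)\<close>.\<close>

type_synonym 'm atlas = "((real^2) set \<times> (real^2 \<Rightarrow> 'm)) set"

definition smooth_atlas :: "'m::t2_space atlas \<Rightarrow> bool" where
  "smooth_atlas P \<longleftrightarrow>
     (\<forall>(U, \<phi>)\<in>P. open U \<and> open (\<phi> ` U) \<and> homeomorphism U (\<phi> ` U) \<phi> (inv_into U \<phi>)) \<and>
     (\<Union>(U, \<phi>)\<in>P. \<phi> ` U) = UNIV \<and>
     (\<forall>(U, \<phi>)\<in>P. \<forall>(V, \<psi>)\<in>P. smooth_on (U \<inter> \<phi> -` (\<psi> ` V)) (inv_into V \<psi> \<circ> \<phi>))"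

definition closed_surface :: "'m::t2_space atlas \<Rightarrow> bool" where
  "closed_surface P \<longleftrightarrow> smooth_atlas P \<and> compact (UNIV :: 'm set)"

definition smooth_map :: "'m atlas \<Rightarrow> ('m \<Rightarrow> 'b::real_normed_vector) \<Rightarrow> bool" where
  "smooth_map P h \<longleftrightarrow> (\<forall>(U, \<phi>)\<in>P. smooth_on U (h \<circ> \<phi>))"

definition smooth_embedding :: "'m::t2_space atlas \<Rightarrow> ('m \<Rightarrow> real^3) \<Rightarrow> bool" where
  "smooth_embedding P f \<longleftrightarrow>
     smooth_map P f \<and>
     (\<forall>(U, \<phi>)\<in>P. \<forall>u\<in>U. inj (frechet_derivative (f \<circ> \<phi>) (at u))) \<and>
     homeomorphism UNIV (range f) f (inv f)"

definition encloses :: "('m \<Rightarrow> real^3) \<Rightarrow> (real^3) set \<Rightarrow> bool" where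
  "encloses f \<Omega> \<longleftrightarrow> open \<Omega> \<and> connected \<Omega> \<and> bounded \<Omega> \<and> frontier \<Omega> = range f"

text \<open>The tangent space of \<open>M\<close> at \<open>x\<close> is identified, via the differential of \<open>f\<close>, with a
  plane in \<open>\<real>\<^sup>3\<close>; the induced metric then is the Euclidean inner product on that plane.\<close>

definition tangent_plane :: "'m atlas \<Rightarrow> ('m \<Rightarrow> real^3) \<Rightarrow> 'm \<Rightarrow> (real^3) set" where
  "tangent_plane P f x =
     {X. \<exists>(U, \<phi>)\<in>P. \<exists>u\<in>U. \<exists>a. \<phi> u = x \<and> X = frechet_derivative (f \<circ> \<phi>) (at u) a}"

definition outward_unit_normal ::
  "'m atlas \<Rightarrow> ('m \<Rightarrow> real^3) \<Rightarrow> (real^3) set \<Rightarrow> ('m \<Rightarrow> real^3) \<Rightarrow> bool" where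
  "outward_unit_normal P f \<Omega> \<nu> \<longleftrightarrow>
     smooth_map P \<nu> \<and>
     (\<forall>x. norm (\<nu> x) = 1 \<and>
          (\<forall>X\<in>tangent_plane P f x. \<nu> x \<bullet> X = 0) \<and>
          (\<forall>\<^sub>F t in at_right 0. f x - t *\<^sub>R \<nu> x \<in> \<Omega> \<and> f x + t *\<^sub>R \<nu> x \<notin> \<Omega>))"


section \<open>Curvature\<close>

text \<open>The derivative of \<open>\<nu>\<close> in direction \<open>X = df(a)\<close> is \<open>d\<nu>(a)\<close>; it is independent of the
  parametrization and, \<open>f\<close> being an immersion, a function of \<open>X\<close>.\<close>

definition normal_derivative ::
  "'m atlas \<Rightarrow> ('m \<Rightarrow> real^3) \<Rightarrow> ('m \<Rightarrow> real^3) \<Rightarrow> 'm \<Rightarrow> real^3 \<Rightarrow> real^3" where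
  "normal_derivative P f \<nu> x X =
     (THE Z. \<exists>(U, \<phi>)\<in>P. \<exists>u\<in>U. \<exists>a. \<phi> u = x \<and>
        X = frechet_derivative (f \<circ> \<phi>) (at u) a \<and> Z = frechet_derivative (\<nu> \<circ> \<phi>) (at u) a)"

definition second_ff ::
  "'m atlas \<Rightarrow> ('m \<Rightarrow> real^3) \<Rightarrow> ('m \<Rightarrow> real^3) \<Rightarrow> 'm \<Rightarrow> real^3 \<Rightarrow> real^3 \<Rightarrow> real" where
  "second_ff P f \<nu> x X Y = normal_derivative P f \<nu> x X \<bullet> Y"

definition principal_curvatures ::
  "'m atlas \<Rightarrow> ('m \<Rightarrow> real^3) \<Rightarrow> ('m \<Rightarrow> real^3) \<Rightarrow> 'm \<Rightarrow> real set" where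
  "principal_curvatures P f \<nu> x =
     {\<kappa>. \<exists>X\<in>tangent_plane P f x. X \<noteq> 0 \<and>
          (\<forall>Y\<in>tangent_plane P f x. second_ff P f \<nu> x X Y = \<kappa> * (X \<bullet> Y))}"

text \<open>At an umbilic point the set of principal curvatures is a singleton, and
  \<open>\<lambda>\<^sub>1 = \<lambda>\<^sub>2\<close> is the double eigenvalue.\<close>

definition lambda1 :: "'m atlas \<Rightarrow> ('m \<Rightarrow> real^3) \<Rightarrow> ('m \<Rightarrow> real^3) \<Rightarrow> 'm \<Rightarrow> real" where
  "lambda1 P f \<nu> x = Max (principal_curvatures P f \<nu> x)"

definition lambda2 :: "'m atlas \<Rightarrow> ('m \<Rightarrow> real^3) \<Rightarrow> ('m \<Rightarrow> real^3) \<Rightarrow> 'm \<Rightarrow> real" where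
  "lambda2 P f \<nu> x = Min (principal_curvatures P f \<nu> x)"

definition E1 :: "'m atlas \<Rightarrow> ('m \<Rightarrow> real^3) \<Rightarrow> ('m \<Rightarrow> real^3) \<Rightarrow> 'm \<Rightarrow> real" where
  "E1 P f \<nu> x = (lambda1 P f \<nu> x + lambda2 P f \<nu> x) / 2"

definition mean_convex :: "'m atlas \<Rightarrow> ('m \<Rightarrow> real^3) \<Rightarrow> ('m \<Rightarrow> real^3) \<Rightarrow> bool" where
  "mean_convex P f \<nu> \<longleftrightarrow> (\<forall>x. E1 P f \<nu> x > 0)"

definition tracefree_second_ff ::
  "'m atlas \<Rightarrow> ('m \<Rightarrow> real^3) \<Rightarrow> ('m \<Rightarrow> real^3) \<Rightarrow> 'm \<Rightarrow> real^3 \<Rightarrow> real^3 \<Rightarrow> real" where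
  "tracefree_second_ff P f \<nu> x X Y = second_ff P f \<nu> x X Y - E1 P f \<nu> x * (X \<bullet> Y)"

text \<open>The squared norm of a bilinear form on the subspace \<open>T\<close>, computed in an orthonormal basis;
  the value does not depend on which one is chosen.\<close>

definition bilinear_norm_sq ::
  "'a::euclidean_space set \<Rightarrow> ('a \<Rightarrow> 'a \<Rightarrow> real) \<Rightarrow> real" where
  "bilinear_norm_sq T B =
     (let E = (SOME E. pairwise orthogonal E \<and> (\<forall>e\<in>E. norm e = 1) \<and> span E = T)
      in \<Sum>e\<in>E. \<Sum>e'\<in>E. (B e e')\<^sup>2)"

definition tracefree_norm_sq ::
  "'m atlas \<Rightarrow> ('m \<Rightarrow> real^3) \<Rightarrow> ('m \<Rightarrow> real^3) \<Rightarrow> 'm \<Rightarrow> real" where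
  "tracefree_norm_sq P f \<nu> x =
     bilinear_norm_sq (tangent_plane P f x) (tracefree_second_ff P f \<nu> x)"


section \<open>Area and oriented volume\<close>

definition area_density :: "('m \<Rightarrow> real^3) \<Rightarrow> (real^2 \<Rightarrow> 'm) \<Rightarrow> real^2 \<Rightarrow> real" where
  "area_density f \<phi> u =
     sqrt (det (\<chi> i j. frechet_derivative (f \<circ> \<phi>) (at u) (axis i 1) \<bullet>
                       frechet_derivative (f \<circ> \<phi>) (at u) (axis j 1) :: real^2^2))"

definition is_area_measure ::
  "'m::t2_space atlas \<Rightarrow> ('m \<Rightarrow> real^3) \<Rightarrow> 'm measure \<Rightarrow> bool" where
  "is_area_measure P f \<mu> \<longleftrightarrow>
     sets \<mu> = sets borel \<and>
     (\<forall>(U, \<phi>)\<in>P. \<forall>B\<in>sets borel. B \<subseteq> U \<longrightarrow>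
        emeasure \<mu> (\<phi> ` B) = (\<integral>\<^sup>+u\<in>B. ennreal (area_density f \<phi> u) \<partial>lborel))"

definition area_measure :: "'m::t2_space atlas \<Rightarrow> ('m \<Rightarrow> real^3) \<Rightarrow> 'm measure" where
  "area_measure P f = (THE \<mu>. is_area_measure P f \<mu>)"

text \<open>The oriented volume of the normal graph \<open>x \<mapsto> f x + w x *\<^sub>R \<nu> x\<close>, as a function of \<open>w\<close>;
  the inner integral is oriented, i.e. changes sign when \<open>w x < 0\<close>.\<close>

definition oriented_volume ::
  "'m::t2_space atlas \<Rightarrow> ('m \<Rightarrow> real^3) \<Rightarrow> ('m \<Rightarrow> real^3) \<Rightarrow> (real^3) set \<Rightarrow> ('m \<Rightarrow> real) \<Rightarrow> real" where
  "oriented_volume P f \<nu> \<Omega> w =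
     measure lebesgue \<Omega> +
     (\<integral>x. (LBINT t=0..ereal (w x). (1 + lambda1 P f \<nu> x * t) * (1 + lambda2 P f \<nu> x * t))
        \<partial>area_measure P f)"

text \<open>The oriented volume \<open>V[b\<^sub>u]\<close> of \<open>b\<^sub>u = f - u \<nu>\<close>.\<close>

definition inner_volume ::
  "'m::t2_space atlas \<Rightarrow> ('m \<Rightarrow> real^3) \<Rightarrow> ('m \<Rightarrow> real^3) \<Rightarrow> (real^3) set \<Rightarrow> ('m \<Rightarrow> real) \<Rightarrow> real" where
  "inner_volume P f \<nu> \<Omega> u = oriented_volume P f \<nu> \<Omega> (\<lambda>x. - u x)"


section \<open>Existence and uniqueness of the area measure\<close>

lemma nn_integral_iff:
  fixes F :: "'a::euclidean_space \<Rightarrow> real"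
  assumes S: "S \<in> sets borel" and F: "continuous_on S F" "\<And>x. x \<in> S \<Longrightarrow> 0 \<le> F x"
  shows "F absolutely_integrable_on S \<and> integral S F = r \<longleftrightarrow>
    (\<integral>\<^sup>+x\<in>S. ennreal (F x) \<partial>lborel) = ennreal r \<and> 0 \<le> r"
proof -
  let ?G = "\<lambda>x. if x \<in> S then F x else 0"
  have mb: "?G \<in> borel_measurable borel"
    by (intro borel_measurable_continuous_on_if S F continuous_on_const)
  have m: "?G \<in> borel_measurable lebesgue"
    using measurable_completion[of ?G lborel borel] mb by simp
  have eq: "(\<integral>\<^sup>+x\<in>S. ennreal (F x) \<partial>lborel) = integral\<^sup>N lebesgue (\<lambda>x. ennreal (?G x))"
    unfolding nn_integral_completion by (intro nn_integral_cong) (auto simp: indicator_def)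
  have "F absolutely_integrable_on S \<and> integral S F = r \<longleftrightarrow> (F has_integral r) S"
    using nonnegative_absolutely_integrable_1[of F S] F(2)
    by (auto simp: has_integral_iff absolutely_integrable_on_def)
  also have "\<dots> \<longleftrightarrow> (?G has_integral r) UNIV"
    by (rule has_integral_restrict_UNIV[symmetric])
  also have "\<dots> \<longleftrightarrow> integral\<^sup>N lebesgue (\<lambda>x. ennreal (?G x)) = ennreal r \<and> 0 \<le> r"
    using F(2) m by (subst has_integral_iff_nn_integral_lebesgue) auto
  finally show ?thesis unfolding eq .
qed

lemma nn_integral_change_of_variables:
  fixes \<tau> :: "real^2 \<Rightarrow> real^2"
  assumes S: "S \<in> sets borel" and T: "\<tau> ` S \<in> sets borel"
    and der: "\<And>x. x \<in> S \<Longrightarrow> (\<tau> has_derivative \<tau>' x) (at x within S)" and inj: "inj_on \<tau> S"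
    and D: "continuous_on (\<tau> ` S) D" "\<And>x. x \<in> \<tau> ` S \<Longrightarrow> 0 \<le> D x"
    and E: "continuous_on S E" "\<And>x. x \<in> S \<Longrightarrow> E x = \<bar>det (matrix (\<tau>' x))\<bar> * D (\<tau> x)"
  shows "(\<integral>\<^sup>+x\<in>\<tau> ` S. ennreal (D x) \<partial>lborel) = (\<integral>\<^sup>+x\<in>S. ennreal (E x) \<partial>lborel)"
proof -
  have SL: "S \<in> sets lebesgue" using S by simp
  have E0: "0 \<le> E x" if "x \<in> S" for x using that D(2) E(2) by auto
  have key: "E absolutely_integrable_on S \<and> integral S E = r \<longleftrightarrow>
        D absolutely_integrable_on (\<tau> ` S) \<and> integral (\<tau> ` S) D = r" for r
  proof -
    let ?V = "\<lambda>v. vec (D v) :: real^1"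
    let ?W = "\<lambda>x. \<bar>det (matrix (\<tau>' x))\<bar> *\<^sub>R ?V (\<tau> x)"
    have cov: "?W absolutely_integrable_on S \<and> integral S ?W = vec r \<longleftrightarrow>
        ?V absolutely_integrable_on (\<tau> ` S) \<and> integral (\<tau> ` S) ?V = vec r"
      by (rule has_absolute_integral_change_of_variables[OF SL der inj])
    have a: "?V absolutely_integrable_on (\<tau> ` S) \<longleftrightarrow> D absolutely_integrable_on (\<tau> ` S)"
      by (simp add: absolutely_integrable_on_1_iff)
    have "?W absolutely_integrable_on S \<longleftrightarrow> (\<lambda>x. \<bar>det (matrix (\<tau>' x))\<bar> * D (\<tau> x)) absolutely_integrable_on S"
      by (simp add: absolutely_integrable_on_1_iff)
    also have "\<dots> \<longleftrightarrow> E absolutely_integrable_on S"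
      unfolding absolutely_integrable_on_def
      using E(2) by (auto cong: integrable_cong)
    finally have b: "?W absolutely_integrable_on S \<longleftrightarrow> E absolutely_integrable_on S" .
    have c: "integral (\<tau> ` S) ?V = vec r \<longleftrightarrow> integral (\<tau> ` S) D = r"
      if "?V absolutely_integrable_on (\<tau> ` S)"
    proof -
      have "integral (\<tau> ` S) ?V = vec (integral (\<tau> ` S) D)"
        using that by (simp add: vec_eq_iff absolutely_integrable_on_def flip: integral_component_eq_cart)
      then show ?thesis by (simp add: vec_eq_iff)
    qed
    have d: "integral S ?W = vec r \<longleftrightarrow> integral S E = r"
      if "?W absolutely_integrable_on S"
    proof -
      have "integral S ?W = vec (integral S (\<lambda>x. \<bar>det (matrix (\<tau>' x))\<bar> * D (\<tau> x)))"
        using that by (simp add: vec_eq_iff absolutely_integrable_on_def flip: integral_component_eq_cart)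
      also have "integral S (\<lambda>x. \<bar>det (matrix (\<tau>' x))\<bar> * D (\<tau> x)) = integral S E"
        by (rule integral_cong) (simp add: E(2))
      finally show ?thesis by (simp add: vec_eq_iff)
    qed
    show ?thesis using cov a b c d by blast
  qed
  let ?I = "\<integral>\<^sup>+x\<in>\<tau> ` S. ennreal (D x) \<partial>lborel" and ?J = "\<integral>\<^sup>+x\<in>S. ennreal (E x) \<partial>lborel"
  have "?J = ennreal r \<and> 0 \<le> r \<longleftrightarrow> ?I = ennreal r \<and> 0 \<le> r" for r
    using key[of r] nn_integral_iff[OF S E(1) E0, of r] nn_integral_iff[OF T D, of r] by blast
  then have *: "?J = ennreal r \<longleftrightarrow> ?I = ennreal r" if "0 \<le> r" for r
    using that by blast
  show ?thesis
  proof (cases ?I)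
    case (real r)
    then show ?thesis using *[of r] by simp
  next
    case top
    show ?thesis
    proof (cases ?J)
      case (real r)
      then show ?thesis using *[of r] by simp
    next
      case top2: top
      show ?thesis unfolding top top2 ..
    qed
  qed
qed

lemma smooth_on_has_derivative:
  assumes "smooth_on S f" "x \<in> S"
  shows "(f has_derivative frechet_derivative f (at x)) (at x)"
proof -
  have "Ck_on (Suc 0) S f" using assms(1) by (auto simp: smooth_on_def)
  then show ?thesis using assms(2) by (auto simp: frechet_derivative_works)
qed

lemma smooth_on_continuous_derivative:
  assumes "smooth_on S f"
  shows "continuous_on S (\<lambda>x. frechet_derivative f (at x) v)"
proof -
  have "Ck_on (Suc 0) S f" using assms(1) by (auto simp: smooth_on_def)
  then show ?thesis by simp
qed

lemma area_density_eq:
  "area_density f \<phi> u =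
    (let a = frechet_derivative (f \<circ> \<phi>) (at u) (axis 1 1); b = frechet_derivative (f \<circ> \<phi>) (at u) (axis 2 1)
     in sqrt ((a \<bullet> a) * (b \<bullet> b) - (a \<bullet> b) * (b \<bullet> a)))"
  by (simp add: area_density_def det_2 Let_def)

lemma area_density_nonneg: "0 \<le> area_density f \<phi> u"
  unfolding area_density_eq Let_def using Cauchy_Schwarz_ineq
  by (simp add: inner_commute power2_eq_square)

lemma area_density_continuous:
  assumes "smooth_on U (f \<circ> \<phi>)"
  shows "continuous_on U (area_density f \<phi>)"
  unfolding area_density_eq Let_def
  by (intro continuous_intros smooth_on_continuous_derivative assms)

lemma det_matrix_2:
  fixes J :: "real^2 \<Rightarrow> real^2"
  shows "det (matrix J) = J (axis 1 1) $ 1 * J (axis 2 1) $ 2 - J (axis 2 1) $ 1 * J (axis 1 1) $ 2"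
  by (simp add: det_2 matrix_def)

lemma axis_decomp_2: "(v::real^2) = v $ 1 *\<^sub>R axis 1 1 + v $ 2 *\<^sub>R axis 2 1"
  by (simp add: vec_eq_iff forall_2 axis_def)

lemma area_density_transition:
  assumes W: "open W" "u \<in> W" and eq: "\<And>v. v \<in> W \<Longrightarrow> \<phi> v = \<psi> (\<tau> v)"
    and \<tau>: "(\<tau> has_derivative J) (at u)"
    and \<psi>: "(f \<circ> \<psi> has_derivative L) (at (\<tau> u))"
  shows "area_density f \<phi> u = \<bar>det (matrix J)\<bar> * area_density f \<psi> (\<tau> u)"
proof -
  have "((f \<circ> \<psi>) \<circ> \<tau> has_derivative L \<circ> J) (at u)"
    by (rule diff_chain_at[OF \<tau> \<psi>])
  then have "(f \<circ> \<phi> has_derivative L \<circ> J) (at u)"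
    by (rule has_derivative_transform_within_open[OF _ W]) (simp add: eq)
  then have 1: "frechet_derivative (f \<circ> \<phi>) (at u) = L \<circ> J"
    by (rule frechet_derivative_at[symmetric])
  have 2: "frechet_derivative (f \<circ> \<psi>) (at (\<tau> u)) = L"
    using \<psi> by (rule frechet_derivative_at[symmetric])
  define p q where "p = L (axis 1 1)" and "q = L (axis 2 1)"
  have "linear L" using \<psi> has_derivative_linear by blast
  have L: "L v = v $ 1 *\<^sub>R p + v $ 2 *\<^sub>R q" for v
    unfolding p_def q_def
    by (subst axis_decomp_2[of v]) (simp add: linear_add[OF \<open>linear L\<close>] linear_scale[OF \<open>linear L\<close>])
  let ?a = "J (axis 1 1)" and ?b = "J (axis 2 1)"
  have g: "(L ?a \<bullet> L ?a) * (L ?b \<bullet> L ?b) - (L ?a \<bullet> L ?b) * (L ?b \<bullet> L ?a) =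
     (det (matrix J))\<^sup>2 * ((p \<bullet> p) * (q \<bullet> q) - (p \<bullet> q) * (q \<bullet> p))"
    unfolding L det_matrix_2
    by (simp add: inner_add_left inner_add_right inner_commute[of q p]) algebra
  show ?thesis
    unfolding area_density_eq Let_def 1 2 o_apply g
    by (simp add: real_sqrt_mult p_def q_def)
qed


lemma countable_atlas:
  fixes P :: "'m::t2_space atlas"
  assumes "closed_surface P"
  obtains U \<phi> where "\<And>n::nat. (U n, \<phi> n) \<in> P" "(\<Union>n. \<phi> n ` U n) = UNIV"
proof -
  let ?C = "(\<lambda>(U, \<phi>). \<phi> ` U) ` P"
  have "compact (UNIV :: 'm set)" "\<And>S. S \<in> ?C \<Longrightarrow> open S" "UNIV \<subseteq> \<Union> ?C"
    using assms by (auto simp: closed_surface_def smooth_atlas_def)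
  then obtain D where D: "D \<subseteq> ?C" "finite D" "UNIV \<subseteq> \<Union> D"
    by (meson compactE)
  have "D \<noteq> {}" using D(3) by auto
  then have r: "range (from_nat_into D) = D"
    using D(2) by (intro range_from_nat_into) (auto simp: countable_finite)
  have "\<forall>n. \<exists>c\<in>P. from_nat_into D n = snd c ` fst c"
  proof
    fix n
    have "from_nat_into D n \<in> ?C"
      using from_nat_into[OF \<open>D \<noteq> {}\<close>] D(1) by (rule subsetD[rotated])
    then show "\<exists>c\<in>P. from_nat_into D n = snd c ` fst c"
      by (auto simp: case_prod_unfold)
  qed
  then obtain c where c: "\<And>n. c n \<in> P" "\<And>n. from_nat_into D n = snd (c n) ` fst (c n)"
    by metis
  show ?thesis
  proof (rule that[of "fst \<circ> c" "snd \<circ> c"])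
    show "((fst \<circ> c) n, (snd \<circ> c) n) \<in> P" for n using c(1) by simp
    have "(\<Union>n. snd (c n) ` fst (c n)) = \<Union> D"
      using r c(2) by (metis (no_types, lifting) image_cong)
    then show "(\<Union>n. (snd \<circ> c) n ` (fst \<circ> c) n) = UNIV"
      using D(3) by auto
  qed
qed

lemma chart_facts:
  assumes "closed_surface P" "(U, \<phi>) \<in> P"
  shows "open U" "open (\<phi> ` U)" "continuous_on U \<phi>" "inj_on \<phi> U"
    "continuous_on (\<phi> ` U) (inv_into U \<phi>)"
proof -
  have "open U \<and> open (\<phi> ` U) \<and> homeomorphism U (\<phi> ` U) \<phi> (inv_into U \<phi>)"
    using assms unfolding closed_surface_def smooth_atlas_def by fast
  then show "open U" "open (\<phi> ` U)" "continuous_on U \<phi>" "continuous_on (\<phi> ` U) (inv_into U \<phi>)"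
    "inj_on \<phi> U"
    by (auto simp: homeomorphism_def intro: inj_on_inverseI)
qed

lemma chart_vimage_borel:
  assumes "closed_surface P" "(U, \<phi>) \<in> P" "A \<in> sets borel"
  shows "U \<inter> \<phi> -` A \<in> sets borel"
proof -
  have "\<phi> \<in> borel_measurable (restrict_space borel U)"
    by (intro borel_measurable_continuous_on_restrict chart_facts[OF assms(1,2)])
  from measurable_sets[OF this assms(3)] chart_facts(1)[OF assms(1,2)]
  show ?thesis
    by (simp add: sets_restrict_space_iff space_restrict_space Int_commute)
qed

lemma chart_image_borel:
  assumes "closed_surface P" "(U, \<phi>) \<in> P" "B \<in> sets borel" "B \<subseteq> U"
  shows "\<phi> ` B \<in> sets borel"
proof -
  note c = chart_facts[OF assms(1,2)]
  have "inv_into U \<phi> \<in> borel_measurable (restrict_space borel (\<phi> ` U))"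
    by (intro borel_measurable_continuous_on_restrict c)
  from measurable_sets[OF this assms(3)] c(2)
  have "inv_into U \<phi> -` B \<inter> \<phi> ` U \<in> sets borel"
    by (simp add: sets_restrict_space_iff space_restrict_space)
  moreover have "inv_into U \<phi> -` B \<inter> \<phi> ` U = \<phi> ` B"
  proof (intro equalityI subsetI)
    fix x assume "x \<in> inv_into U \<phi> -` B \<inter> \<phi> ` U"
    then show "x \<in> \<phi> ` B" by (metis IntE f_inv_into_f imageI vimageE)
  next
    fix x assume "x \<in> \<phi> ` B"
    then obtain u where u: "u \<in> B" "x = \<phi> u" by blast
    then have "inv_into U \<phi> x = u" using assms(4) c(4) by (auto intro: inv_into_f_f)
    then show "x \<in> inv_into U \<phi> -` B \<inter> \<phi> ` U" using u assms(4) by auto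
  qed
  ultimately show ?thesis by simp
qed

lemma area_transition:
  assumes cs: "closed_surface P" and f: "smooth_map P f"
    and c: "(U, \<phi>) \<in> P" "(V, \<psi>) \<in> P"
    and B: "B \<in> sets borel" "B \<subseteq> U" and C: "C \<in> sets borel" "C \<subseteq> V" and BC: "\<phi> ` B = \<psi> ` C"
  shows "(\<integral>\<^sup>+u\<in>B. ennreal (area_density f \<phi> u) \<partial>lborel) =
         (\<integral>\<^sup>+u\<in>C. ennreal (area_density f \<psi> u) \<partial>lborel)"
proof -
  note cU = chart_facts[OF cs c(1)] and cV = chart_facts[OF cs c(2)]
  define \<tau> where "\<tau> = inv_into V \<psi> \<circ> \<phi>"
  define W where "W = U \<inter> \<phi> -` (\<psi> ` V)"
  have W: "open W"
    unfolding W_def using continuous_open_preimage[OF cU(3) cU(1) cV(2)] .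
  have BW: "B \<subseteq> W"
  proof
    fix u assume u: "u \<in> B"
    then have "\<phi> u \<in> \<psi> ` C" using BC by (metis imageI)
    then show "u \<in> W" using u B(2) C(2) unfolding W_def by auto
  qed
  have st: "smooth_on W \<tau>"
  proof -
    have "\<forall>(U, \<phi>)\<in>P. \<forall>(V, \<psi>)\<in>P. smooth_on (U \<inter> \<phi> -` (\<psi> ` V)) (inv_into V \<psi> \<circ> \<phi>)"
      using cs by (simp add: closed_surface_def smooth_atlas_def)
    from bspec[OF this c(1)] have
      "\<forall>(V, \<psi>)\<in>P. smooth_on (U \<inter> \<phi> -` (\<psi> ` V)) (inv_into V \<psi> \<circ> \<phi>)" by simp
    from bspec[OF this c(2)] show ?thesis by (simp add: W_def \<tau>_def)
  qed
  have sf: "smooth_on U (f \<circ> \<phi>)" "smooth_on V (f \<circ> \<psi>)"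
    using f c unfolding smooth_map_def by fast+
  have \<psi>\<tau>: "\<psi> (\<tau> v) = \<phi> v" "\<tau> v \<in> V" if "v \<in> W" for v
    using that unfolding W_def \<tau>_def by (auto simp: f_inv_into_f inv_into_into)
  have im: "\<tau> ` B = C"
  proof
    show "\<tau> ` B \<subseteq> C"
    proof
      fix y assume "y \<in> \<tau> ` B"
      then obtain u where u: "u \<in> B" "y = \<tau> u" by auto
      then obtain v where "v \<in> C" "\<phi> u = \<psi> v" using BC by (metis imageE imageI)
      then show "y \<in> C" using u cV(4) C(2) by (auto simp: \<tau>_def inv_into_f_f subset_iff)
    qed
    show "C \<subseteq> \<tau> ` B"
    proof
      fix v assume v: "v \<in> C"
      then obtain u where "u \<in> B" "\<phi> u = \<psi> v" using BC by (metis imageE imageI)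
      then show "v \<in> \<tau> ` B" using v cV(4) C(2) by (force simp: \<tau>_def inv_into_f_f subset_iff)
    qed
  qed
  have dt: "(\<tau> has_derivative frechet_derivative \<tau> (at u)) (at u)" if "u \<in> W" for u
    using smooth_on_has_derivative[OF st that] .
  have "(\<integral>\<^sup>+u\<in>\<tau> ` B. ennreal (area_density f \<psi> u) \<partial>lborel) =
      (\<integral>\<^sup>+u\<in>B. ennreal (area_density f \<phi> u) \<partial>lborel)"
  proof (rule nn_integral_change_of_variables)
    show "B \<in> sets borel" "\<tau> ` B \<in> sets borel" using B C im by auto
    show "(\<tau> has_derivative frechet_derivative \<tau> (at u)) (at u within B)" if "u \<in> B" for u
      using has_derivative_at_withinI[OF dt] subsetD[OF BW that] by simp
    show "inj_on \<tau> B"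
      using \<psi>\<tau>(1) BW cU(4) B(2) by (metis (no_types, lifting) inj_on_def subsetD)
    show "continuous_on (\<tau> ` B) (area_density f \<psi>)"
      using area_density_continuous[OF sf(2)] C(2) im continuous_on_subset by blast
    show "continuous_on B (area_density f \<phi>)"
      using area_density_continuous[OF sf(1)] B(2) continuous_on_subset by blast
    show "0 \<le> area_density f \<psi> x" for x by (rule area_density_nonneg)
    show "area_density f \<phi> u = \<bar>det (matrix (frechet_derivative \<tau> (at u)))\<bar> * area_density f \<psi> (\<tau> u)"
      if "u \<in> B" for u
    proof (rule area_density_transition[OF W])
      show "u \<in> W" using that BW by auto
      then show "(\<tau> has_derivative frechet_derivative \<tau> (at u)) (at u)" by (rule dt)
      show "(f \<circ> \<psi> has_derivative frechet_derivative (f \<circ> \<psi>) (at (\<tau> u))) (at (\<tau> u))"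
        using smooth_on_has_derivative[OF sf(2)] \<psi>\<tau>(2) \<open>u \<in> W\<close> by blast
      show "\<phi> v = \<psi> (\<tau> v)" if "v \<in> W" for v using \<psi>\<tau> that by simp
    qed
  qed
  then show ?thesis unfolding im by simp
qed

lemma borel_partition:
  fixes P :: "'m::t2_space atlas"
  assumes "closed_surface P"
  obtains U \<phi> A where "\<And>n::nat. (U n, \<phi> n) \<in> P" "\<And>n. A n \<subseteq> \<phi> n ` U n" "\<And>n. A n \<in> sets borel"
    "disjoint_family A" "(\<Union>n. A n) = UNIV"
proof -
  obtain U \<phi> where c: "\<And>n::nat. (U n, \<phi> n) \<in> P" "(\<Union>n. \<phi> n ` U n) = UNIV"
    by (rule countable_atlas[OF assms]) (rule that)
  let ?A = "disjointed (\<lambda>n. \<phi> n ` U n)"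
  show ?thesis
  proof (rule that[of U \<phi> ?A])
    show "(U n, \<phi> n) \<in> P" for n by (rule c)
    show "?A n \<subseteq> \<phi> n ` U n" for n by (rule disjointed_subset)
    have "range (\<lambda>n. \<phi> n ` U n) \<subseteq> sets borel"
      using chart_facts(2)[OF assms c(1)] by auto
    then show "?A n \<in> sets borel" for n
      using sets.range_disjointed_sets by blast
    show "disjoint_family ?A" by (rule disjoint_family_disjointed)
    show "(\<Union>n. ?A n) = UNIV" using c(2) by (simp add: UN_disjointed_eq)
  qed
qed

lemma is_area_measure_unique:
  fixes P :: "'m::t2_space atlas"
  assumes cs: "closed_surface P" and "is_area_measure P f \<mu>" "is_area_measure P f \<mu>'"
  shows "\<mu> = \<mu>'"
proof (rule measure_eqI)
  show sets: "sets \<mu> = sets \<mu>'" using assms by (simp add: is_area_measure_def)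
  fix S assume "S \<in> sets \<mu>"
  then have S: "S \<in> sets borel" using assms by (simp add: is_area_measure_def)
  obtain U \<phi> A where c: "\<And>n::nat. (U n, \<phi> n) \<in> P" and A: "\<And>n. A n \<subseteq> \<phi> n ` U n"
    "\<And>n. A n \<in> sets borel" "disjoint_family A" "(\<Union>n. A n) = UNIV"
    by (rule borel_partition[OF cs]) (rule that)
  define B where "B n = U n \<inter> \<phi> n -` (S \<inter> A n)" for n
  have B: "B n \<in> sets borel" "B n \<subseteq> U n" for n
    unfolding B_def by (intro chart_vimage_borel[OF cs c] sets.Int S A(2)) auto
  have BA: "\<phi> n ` B n = S \<inter> A n" for n
    unfolding B_def using A(1)[of n] by auto
  have sum: "emeasure M S = (\<Sum>n. \<integral>\<^sup>+u\<in>B n. ennreal (area_density f (\<phi> n) u) \<partial>lborel)"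
    if M: "is_area_measure P f M" for M
  proof -
    have sM: "sets M = sets borel" using M by (simp add: is_area_measure_def)
    have "emeasure M S = emeasure M (\<Union>n. S \<inter> A n)"
      by (simp only: Int_UN_distrib[symmetric] A(4) Int_UNIV_right)
    also have "\<dots> = (\<Sum>n. emeasure M (S \<inter> A n))"
      using A(2,3) S sM by (intro suminf_emeasure[symmetric]) (auto simp: disjoint_family_on_def)
    also have "\<dots> = (\<Sum>n. \<integral>\<^sup>+u\<in>B n. ennreal (area_density f (\<phi> n) u) \<partial>lborel)"
    proof (rule suminf_cong)
      fix n
      show "emeasure M (S \<inter> A n) = (\<integral>\<^sup>+u\<in>B n. ennreal (area_density f (\<phi> n) u) \<partial>lborel)"
        using M[unfolded is_area_measure_def, THEN conjunct2, THEN bspec, OF c[of n]] B[of n]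
        by (simp flip: BA)
    qed
    finally show ?thesis .
  qed
  show "emeasure \<mu> S = emeasure \<mu>' S" using sum[OF assms(2)] sum[OF assms(3)] by simp
qed

lemma is_area_measure_exists:
  fixes P :: "'m::t2_space atlas"
  assumes cs: "closed_surface P" and f: "smooth_map P f"
  shows "\<exists>\<mu>. is_area_measure P f \<mu>"
proof -
  obtain U \<phi> A where c: "\<And>n::nat. (U n, \<phi> n) \<in> P" and A: "\<And>n. A n \<subseteq> \<phi> n ` U n"
    "\<And>n. A n \<in> sets borel" "disjoint_family A" "(\<Union>n. A n) = UNIV"
    by (rule borel_partition[OF cs]) (rule that)
  define B where "B n = U n \<inter> \<phi> n -` A n" for n
  have B: "B n \<in> sets borel" "B n \<subseteq> U n" for n
    unfolding B_def using chart_vimage_borel[OF cs c] A(2) by auto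
  define d where "d n u = ennreal (if u \<in> U n then area_density f (\<phi> n) u else 0) * indicator (B n) u" for n u
  define h where "h n u = (if u \<in> U n then \<phi> n u else undefined)" for n u
  let ?N = "count_space (UNIV :: nat set) \<Otimes>\<^sub>M lborel :: (nat \<times> (real^2)) measure"
  have sf: "smooth_on U' (f \<circ> \<phi>')" if "(U', \<phi>') \<in> P" for U' \<phi>'
    using f that unfolding smooth_map_def by fast
  have dens: "(\<lambda>u. if u \<in> U' then area_density f \<phi>' u else 0) \<in> borel_measurable borel"
    if "(U', \<phi>') \<in> P" for U' \<phi>'
    using chart_facts(1)[OF cs that] area_density_continuous[OF sf[OF that]]
    by (intro borel_measurable_continuous_on_if) auto
  have [measurable]: "d n \<in> borel_measurable borel" for n
    unfolding d_def using dens[OF c, of n] B(1)[of n] by measurable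
  have [measurable]: "h n \<in> borel_measurable borel" for n
    unfolding h_def using chart_facts[OF cs c, of n]
    by (intro borel_measurable_continuous_on_if) auto
  have dm: "(\<lambda>p. d (fst p) (snd p)) \<in> borel_measurable ?N"
    by (rule measurable_pair_measure_countable1) auto
  have hm: "(\<lambda>p. h (fst p) (snd p)) \<in> borel_measurable ?N"
    by (rule measurable_pair_measure_countable1) auto
  define \<mu> where "\<mu> = distr (density ?N (\<lambda>p. d (fst p) (snd p))) borel (\<lambda>p. h (fst p) (snd p))"
  have em: "emeasure \<mu> S = (\<Sum>n. \<integral>\<^sup>+u. d n u * indicator S (h n u) \<partial>lborel)"
    if S: "S \<in> sets borel" for S
  proof -
    have 1: "(\<lambda>p. h (fst p) (snd p)) -` S \<inter> space ?N \<in> sets ?N"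
      using measurable_sets[OF hm S] .
    have ind: "(\<lambda>p. indicator S (h (fst p) (snd p)) :: ennreal) \<in> borel_measurable ?N"
      using measurable_compose[OF hm borel_measurable_indicator[OF S]] .
    have "emeasure \<mu> S = emeasure (density ?N (\<lambda>p. d (fst p) (snd p)))
        ((\<lambda>p. h (fst p) (snd p)) -` S \<inter> space ?N)"
      unfolding \<mu>_def using hm S by (subst emeasure_distr) auto
    also have "\<dots> = (\<integral>\<^sup>+p. d (fst p) (snd p) *
        indicator ((\<lambda>p. h (fst p) (snd p)) -` S \<inter> space ?N) p \<partial>?N)"
      by (rule emeasure_density[OF dm 1])
    also have "\<dots> = (\<integral>\<^sup>+p. d (fst p) (snd p) * indicator S (h (fst p) (snd p)) \<partial>?N)"
      by (intro nn_integral_cong) (auto simp: indicator_def)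
    also have "\<dots> = (\<integral>\<^sup>+n. \<integral>\<^sup>+u. d n u * indicator S (h n u) \<partial>lborel \<partial>count_space UNIV)"
      using lborel.nn_integral_fst[OF borel_measurable_times_ennreal[OF dm ind]] by simp
    finally show ?thesis by (simp add: nn_integral_count_space_nat)
  qed
  have "is_area_measure P f \<mu>"
    unfolding is_area_measure_def
  proof (safe)
    show "x \<in> sets \<mu> \<Longrightarrow> x \<in> sets borel" "x \<in> sets borel \<Longrightarrow> x \<in> sets \<mu>" for x
      by (auto simp: \<mu>_def)
    fix V \<psi> T assume V: "(V, \<psi>) \<in> P" and T: "T \<in> sets borel" "T \<subseteq> V"
    note cV = chart_facts[OF cs V]
    have im: "\<psi> ` T \<in> sets borel" using chart_image_borel[OF cs V T] .
    define C where "C n = U n \<inter> \<phi> n -` (A n \<inter> \<psi> ` T)" for n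
    define D where "D n = T \<inter> (V \<inter> \<psi> -` A n)" for n
    have C: "C n \<in> sets borel" "C n \<subseteq> U n" for n
      unfolding C_def by (intro chart_vimage_borel[OF cs c] sets.Int im A(2)) auto
    have D: "D n \<in> sets borel" "D n \<subseteq> V" for n
      unfolding D_def using chart_vimage_borel[OF cs V] A(2) T by auto
    have CD: "\<phi> n ` C n = \<psi> ` D n" for n
    proof -
      have "\<phi> n ` C n = \<phi> n ` U n \<inter> (A n \<inter> \<psi> ` T)" unfolding C_def by auto
      also have "\<dots> = A n \<inter> \<psi> ` T" using A(1)[of n] by auto
      also have "\<dots> = \<psi> ` D n" unfolding D_def using T(2) by auto
      finally show ?thesis .
    qed
    let ?g = "\<lambda>u. ennreal (if u \<in> V then area_density f \<psi> u else 0)"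
    have gm: "?g \<in> borel_measurable lborel" using dens[OF V] by simp
    have "emeasure \<mu> (\<psi> ` T) = (\<Sum>n. \<integral>\<^sup>+u. d n u * indicator (\<psi> ` T) (h n u) \<partial>lborel)"
      by (rule em[OF im])
    also have "\<dots> = (\<Sum>n. \<integral>\<^sup>+u. ?g u * indicator (D n) u \<partial>lborel)"
    proof (rule suminf_cong)
      fix n
      have "(\<integral>\<^sup>+u. d n u * indicator (\<psi> ` T) (h n u) \<partial>lborel) =
          (\<integral>\<^sup>+u\<in>C n. ennreal (area_density f (\<phi> n) u) \<partial>lborel)"
        by (intro nn_integral_cong) (auto simp: d_def h_def C_def B_def indicator_def)
      also have "\<dots> = (\<integral>\<^sup>+u\<in>D n. ennreal (area_density f \<psi> u) \<partial>lborel)"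
        by (rule area_transition[OF cs f c V C D CD])
      also have "\<dots> = (\<integral>\<^sup>+u. ?g u * indicator (D n) u \<partial>lborel)"
        using D(2) by (intro nn_integral_cong) (auto simp: indicator_def)
      finally show "(\<integral>\<^sup>+u. d n u * indicator (\<psi> ` T) (h n u) \<partial>lborel) =
          (\<integral>\<^sup>+u. ?g u * indicator (D n) u \<partial>lborel)" .
    qed
    also have "\<dots> = (\<Sum>n. emeasure (density lborel ?g) (D n))"
      using D(1) gm by (simp add: emeasure_density)
    also have "\<dots> = emeasure (density lborel ?g) (\<Union>n. D n)"
      using D(1) A(3) by (intro suminf_emeasure) (auto simp: disjoint_family_on_def D_def)
    also have "(\<Union>n. D n) = T"
    proof -
      have "(\<Union>n. D n) = T \<inter> V \<inter> \<psi> -` (\<Union>n. A n)" unfolding D_def by auto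
      then show ?thesis using A(4) T(2) by auto
    qed
    also have "emeasure (density lborel ?g) T = (\<integral>\<^sup>+u. ?g u * indicator T u \<partial>lborel)"
      using T(1) gm by (simp add: emeasure_density)
    also have "\<dots> = (\<integral>\<^sup>+u\<in>T. ennreal (area_density f \<psi> u) \<partial>lborel)"
      using T(2) by (intro nn_integral_cong) (auto simp: indicator_def)
    finally show "emeasure \<mu> (\<psi> ` T) = (\<integral>\<^sup>+u\<in>T. ennreal (area_density f \<psi> u) \<partial>lborel)" .
  qed
  then show ?thesis by blast
qed

lemma is_area_measure_area_measure:
  assumes "closed_surface P" "smooth_map P f"
  shows "is_area_measure P f (area_measure P f)"
  unfolding area_measure_def
  by (rule theI') (use is_area_measure_exists[OF assms] is_area_measure_unique[OF assms(1)] in blast)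

end

theory Submission
  imports Defs
begin

text \<open>The fibre integral of the signed Jacobian is a polynomial in \<open>\<lambda>\<^sub>1\<close>, \<open>\<lambda>\<^sub>2\<close> and the height, and
  \<open>|A - E\<^sub>1 g|\<^sup>2 = (\<lambda>\<^sub>1 - \<lambda>\<^sub>2)\<^sup>2 / 2\<close>; hence both identities hold pointwise under the integral sign once
  the absolute value is resolved, that is, once the oriented volume at depth \<open>1 / \<lambda>\<^sub>1\<close> is known to
  be nonpositive. For this, join a point \<open>p\<close> of \<open>\<Omega>\<close> to a nearest boundary point \<open>f x\<close>. The
  first-order condition for the distance gives \<open>p = f x - d \<nu> x\<close>, the second-order condition gives
  \<open>d \<lambda>\<^sub>1 \<le> 1\<close>. So the inward normal map, restricted to depths at most \<open>1 / \<lambda>\<^sub>1\<close>, where its Jacobian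
  is nonnegative, covers \<open>\<Omega>\<close>, and \<open>|\<Omega>|\<close> is at most the integral of that Jacobian.\<close>

section \<open>Second derivatives and symmetric operators on a plane\<close>

text \<open>Several objects are defined by selection: \<open>normal_derivative\<close> by a definite
  description over all charts, \<open>lambda1\<close> and \<open>lambda2\<close> as extrema of a set
  of eigenvalues, the norm of a bilinear form through a chosen orthonormal basis. They become
  computable because differentials of \<open>f\<close> and \<nu> change charts by the same linear
  map, and because sum and product of the curvatures are the coefficients of one quadratic, whose
  discriminant is nonnegative by symmetry of the second fundamental form. Sum and product are also
  what the Jacobian and the continuity proof work with, and they behave well at umbilic points,
  where the two eigenvalues merge. The truncated normal map may cover a point several times. This
  does no harm, since the measure of an image is at most the integral of the absolute
  Jacobian.\<close>

lemma has_real_derivative_along_line: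
  fixes G :: "'a::real_normed_vector \<Rightarrow> real"
  assumes "(G has_derivative G') (at (x + t *\<^sub>R a))"
  shows "((\<lambda>t. G (x + t *\<^sub>R a)) has_real_derivative G' a) (at t)"
proof -
  have "((\<lambda>t. x + t *\<^sub>R a) has_derivative (\<lambda>h. h *\<^sub>R a)) (at t)"
    by (auto intro!: derivative_eq_intros)
  from diff_chain_at[OF this assms]
  have "((\<lambda>t. G (x + t *\<^sub>R a)) has_derivative (\<lambda>h. G' (h *\<^sub>R a))) (at t)"
    by (simp add: o_def)
  moreover have "G' (h *\<^sub>R a) = G' a * h" for h
    using linear_scale[OF has_derivative_linear[OF assms]] by simp
  ultimately show ?thesis by (simp add: has_field_derivative_def)
qed

text \<open>The mean value theorem is applied twice: along \<open>a\<close> to the difference of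
  \<open>G\<close> between two parallel sides of the parallelogram, then along \<open>b\<close> to
  the derivative found there. The exact equality at an interior point leaves the passage to the
  limit to continuity alone.\<close>

lemma second_difference_mvt:
  fixes G :: "'a::real_normed_vector \<Rightarrow> real"
  assumes h: "0 < h"
    and S: "\<And>s t. \<lbrakk>0 \<le> s; s \<le> h; 0 \<le> t; t \<le> h\<rbrakk> \<Longrightarrow> x + s *\<^sub>R a + t *\<^sub>R b \<in> S"
    and G: "\<And>y. y \<in> S \<Longrightarrow> (G has_derivative G' y) (at y)"
    and A: "\<And>y. y \<in> S \<Longrightarrow> ((\<lambda>y. G' y a) has_derivative A y) (at y)"
  obtains s t where "0 < s" "s < h" "0 < t" "t < h"
    "G (x + h *\<^sub>R a + h *\<^sub>R b) - G (x + h *\<^sub>R a) - G (x + h *\<^sub>R b) + G x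
      = h * h * A (x + s *\<^sub>R a + t *\<^sub>R b) b"
proof -
  let ?\<phi> = "\<lambda>s. G (x + h *\<^sub>R b + s *\<^sub>R a) - G (x + s *\<^sub>R a)"
  have "\<exists>s. 0 < s \<and> s < h \<and> ?\<phi> h - ?\<phi> 0 =
      (h - 0) * (G' (x + h *\<^sub>R b + s *\<^sub>R a) a - G' (x + s *\<^sub>R a) a)"
  proof (rule MVT2[OF h])
    fix s :: real assume s: "0 \<le> s" "s \<le> h"
    show "(?\<phi> has_real_derivative
        G' (x + h *\<^sub>R b + s *\<^sub>R a) a - G' (x + s *\<^sub>R a) a) (at s)"
      using G[OF S[OF s, of h]] G[OF S[OF s, of 0]] h
      by (intro DERIV_diff has_real_derivative_along_line) (simp_all add: algebra_simps)
  qed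
  then obtain s where s: "0 < s" "s < h" "?\<phi> h - ?\<phi> 0 =
      h * (G' (x + h *\<^sub>R b + s *\<^sub>R a) a - G' (x + s *\<^sub>R a) a)" by auto
  let ?\<psi> = "\<lambda>t. G' (x + s *\<^sub>R a + t *\<^sub>R b) a"
  have "\<exists>t. 0 < t \<and> t < h \<and> ?\<psi> h - ?\<psi> 0 = (h - 0) * A (x + s *\<^sub>R a + t *\<^sub>R b) b"
  proof (rule MVT2[OF h])
    fix t :: real assume t: "0 \<le> t" "t \<le> h"
    show "(?\<psi> has_real_derivative A (x + s *\<^sub>R a + t *\<^sub>R b) b) (at t)"
      using A[OF S[of s t]] s t by (intro has_real_derivative_along_line) simp_all
  qed
  then obtain t where t: "0 < t" "t < h" "?\<psi> h - ?\<psi> 0 = h * A (x + s *\<^sub>R a + t *\<^sub>R b) b"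
    by auto
  have "?\<phi> h - ?\<phi> 0 = h * (h * A (x + s *\<^sub>R a + t *\<^sub>R b) b)"
    unfolding t(3)[symmetric] s(3) by (simp add: algebra_simps)
  with s(1,2) t(1,2) show ?thesis
    by (intro that[of s t]) (simp_all add: algebra_simps)
qed

text \<open>The second difference is symmetric in \<open>a\<close> and \<open>b\<close>, so it has
  two mean value forms, one with \<open>A\<close> and one with \<open>B\<close>. On a small
  parallelogram continuity brings them within half the distance of \<open>A x b\<close> and
  \<open>B x a\<close>, which is contradictory if these differ.\<close>

lemma second_derivative_symmetric:
  fixes G :: "'a::real_normed_vector \<Rightarrow> real"
  assumes S: "open S" "x \<in> S"
    and G: "\<And>y. y \<in> S \<Longrightarrow> (G has_derivative G' y) (at y)"
    and A: "\<And>y. y \<in> S \<Longrightarrow> ((\<lambda>y. G' y a) has_derivative A y) (at y)"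
    and B: "\<And>y. y \<in> S \<Longrightarrow> ((\<lambda>y. G' y b) has_derivative B y) (at y)"
    and cont: "continuous_on S (\<lambda>y. A y b)" "continuous_on S (\<lambda>y. B y a)"
  shows "A x b = B x a"
proof (rule ccontr)
  assume "A x b \<noteq> B x a"
  then have e: "0 < dist (A x b) (B x a) / 2" (is "0 < ?e") by simp
  obtain r0 where r0: "0 < r0" "ball x r0 \<subseteq> S" using S by (meson open_contains_ball)
  have "isCont (\<lambda>y. A y b) x" "isCont (\<lambda>y. B y a) x"
    using cont S by (auto simp: continuous_on_eq_continuous_at)
  with e have "\<exists>r>0. \<forall>y. dist y x < r \<longrightarrow> dist (A y b) (A x b) < ?e"
    "\<exists>r>0. \<forall>y. dist y x < r \<longrightarrow> dist (B y a) (B x a) < ?e"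
    unfolding continuous_at_eps_delta by blast+
  then obtain r1 r2 where r: "0 < r1" "0 < r2"
    "\<And>y. dist y x < r1 \<Longrightarrow> dist (A y b) (A x b) < ?e"
    "\<And>y. dist y x < r2 \<Longrightarrow> dist (B y a) (B x a) < ?e" by blast
  define R where "R = min r0 (min r1 r2)"
  \<comment> \<open>This side length keeps the whole parallelogram within distance R of x; the
    summand 1 covers the case that \<open>a\<close> and \<open>b\<close> both vanish.\<close>
  define h where "h = R / (2 * (norm a + norm b + 1))"
  have R: "0 < R" using r0 r by (simp add: R_def)
  have n: "0 < norm a + norm b + 1" by (simp add: add_nonneg_pos)
  have h: "0 < h" using R n by (simp add: h_def)
  have "h * (norm a + norm b) < R"
  proof -
    have "h * (norm a + norm b) \<le> h * (norm a + norm b + 1)" using h by simp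
    also have "\<dots> = R / 2" using n by (simp add: h_def field_simps)
    also have "\<dots> < R" using R by simp
    finally show ?thesis .
  qed
  then have near: "dist (x + s *\<^sub>R a + t *\<^sub>R b) x < R"
    if "0 \<le> s" "s \<le> h" "0 \<le> t" "t \<le> h" for s t
  proof -
    have "norm (s *\<^sub>R a + t *\<^sub>R b) \<le> s * norm a + t * norm b"
      using norm_triangle_ineq[of "s *\<^sub>R a" "t *\<^sub>R b"] that by simp
    also have "\<dots> \<le> h * norm a + h * norm b"
      using that by (intro add_mono mult_right_mono) auto
    finally show ?thesis using \<open>h * (norm a + norm b) < R\<close>
      by (simp add: dist_norm algebra_simps)
  qed
  have inS: "x + s *\<^sub>R a + t *\<^sub>R b \<in> S" if "0 \<le> s" "s \<le> h" "0 \<le> t" "t \<le> h" for s t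
    using near[OF that] r0(2) by (auto simp: R_def dist_commute)
  then have inS': "x + s *\<^sub>R b + t *\<^sub>R a \<in> S" if "0 \<le> s" "s \<le> h" "0 \<le> t" "t \<le> h" for s t
    using that by (metis add.assoc add.commute)
  obtain s t where 1: "0 < s" "s < h" "0 < t" "t < h"
    "G (x + h *\<^sub>R a + h *\<^sub>R b) - G (x + h *\<^sub>R a) - G (x + h *\<^sub>R b) + G x
      = h * h * A (x + s *\<^sub>R a + t *\<^sub>R b) b"
    by (rule second_difference_mvt[OF h inS G A])
  obtain s' t' where 2: "0 < s'" "s' < h" "0 < t'" "t' < h"
    "G (x + h *\<^sub>R b + h *\<^sub>R a) - G (x + h *\<^sub>R b) - G (x + h *\<^sub>R a) + G x
      = h * h * B (x + s' *\<^sub>R b + t' *\<^sub>R a) a"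
    by (rule second_difference_mvt[OF h inS' G B])
  have "h * h * A (x + s *\<^sub>R a + t *\<^sub>R b) b = h * h * B (x + s' *\<^sub>R b + t' *\<^sub>R a) a"
    unfolding 1(5)[symmetric] 2(5)[symmetric] by (simp add: algebra_simps)
  then have AB: "A (x + s *\<^sub>R a + t *\<^sub>R b) b = B (x + s' *\<^sub>R b + t' *\<^sub>R a) a" using h by simp
  have "dist (A (x + s *\<^sub>R a + t *\<^sub>R b) b) (A x b) < ?e"
    using near[of s t] 1 by (intro r(3)) (simp add: R_def)
  moreover have "dist (B (x + s' *\<^sub>R b + t' *\<^sub>R a) a) (B x a) < ?e"
    using near[of t' s'] 2 by (intro r(4)) (simp add: R_def add_ac)
  ultimately show False unfolding AB using dist_triangle_half_r by blast
qed

lemma smooth_on_frechet_derivative: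
  assumes "smooth_on S f"
  shows "smooth_on S (\<lambda>x. frechet_derivative f (at x) v)"
  unfolding smooth_on_def
proof
  fix k
  have "Ck_on (Suc k) S f" using assms by (auto simp: smooth_on_def)
  then show "Ck_on k S (\<lambda>x. frechet_derivative f (at x) v)" by simp
qed

section \<open>Eigenvalues of a symmetric operator on a plane\<close>

lemma quadratic_root_set:
  fixes D S K :: real
  assumes D: "0 < D" and disc: "4 * D * K \<le> S\<^sup>2"
  defines "R \<equiv> {\<kappa>. D * \<kappa>\<^sup>2 - S * \<kappa> + K = 0}"
  shows "Max R \<in> R" "Min R \<le> Max R" "Max R + Min R = S / D" "Max R * Min R = K / D"
proof -
  define q where "q = sqrt (S\<^sup>2 - 4 * D * K)"
  have q: "0 \<le> q" "q\<^sup>2 = S\<^sup>2 - 4 * D * K" using disc by (auto simp: q_def)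
  define r s where "r = (S + q) / (2 * D)" and "s = (S - q) / (2 * D)"
  have rs: "r + s = S / D" "r * s = K / D" "s \<le> r"
  proof -
    show "r + s = S / D" using D by (simp add: r_def s_def field_simps)
    have "r * s = ((S + q) * (S - q)) / (4 * D\<^sup>2)"
      by (simp add: r_def s_def power2_eq_square)
    also have "(S + q) * (S - q) = S\<^sup>2 - q\<^sup>2" by (simp add: power2_eq_square algebra_simps)
    also have "(S\<^sup>2 - q\<^sup>2) / (4 * D\<^sup>2) = K / D"
      using D unfolding q(2) by (simp add: power2_eq_square)
    finally show "r * s = K / D" .
    show "s \<le> r" unfolding r_def s_def using D q(1) by (intro divide_right_mono) auto
  qed
  have "D * \<kappa>\<^sup>2 - S * \<kappa> + K = D * ((\<kappa> - r) * (\<kappa> - s))" for \<kappa>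
  proof -
    have "D * ((\<kappa> - r) * (\<kappa> - s)) = D * \<kappa>\<^sup>2 - D * (r + s) * \<kappa> + D * (r * s)"
      by (simp add: power2_eq_square algebra_simps)
    also have "\<dots> = D * \<kappa>\<^sup>2 - S * \<kappa> + K" using D by (simp add: rs)
    finally show ?thesis ..
  qed
  \<comment> \<open>For q = 0 the roots coincide and the set is a singleton, as at an umbilic point;
    \<open>Max\<close> and \<open>Min\<close> then both return the double root, and Vieta's formulas
    persist.\<close>
  then have R: "R = {r, s}" using D by (auto simp: R_def)
  have "Max R = r" "Min R = s" using rs(3) by (auto simp: R)
  then show "Max R \<in> R" "Min R \<le> Max R" "Max R + Min R = S / D" "Max R * Min R = K / D"
    using rs by (auto simp: R)
qed

text \<open>Pairing the relation with \<open>X\<close> and with \<open>Y\<close> gives a linear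
  system for the coefficients whose determinant is the Gram determinant.\<close>

lemma gram_combination_eq_0:
  fixes X Y :: "'a::real_inner"
  assumes D: "(X \<bullet> X) * (Y \<bullet> Y) - (X \<bullet> Y)\<^sup>2 \<noteq> 0" and "c *\<^sub>R X + d *\<^sub>R Y = 0"
  shows "c = 0 \<and> d = 0"
proof -
  have "c * (X \<bullet> X) + d * (X \<bullet> Y) = 0" "c * (X \<bullet> Y) + d * (Y \<bullet> Y) = 0"
    using arg_cong[OF assms(2), of "\<lambda>Z. Z \<bullet> X"] arg_cong[OF assms(2), of "\<lambda>Z. Z \<bullet> Y"]
    by (simp_all add: inner_add_left inner_commute[of Y X])
  then have "c * ((X \<bullet> X) * (Y \<bullet> Y) - (X \<bullet> Y)\<^sup>2) = 0" "d * ((X \<bullet> X) * (Y \<bullet> Y) - (X \<bullet> Y)\<^sup>2) = 0"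
    by algebra+
  then show ?thesis using D by simp
qed

lemma in_span_pair: "(Z::'a::real_vector) \<in> span {X, Y} \<longleftrightarrow> (\<exists>c d. Z = c *\<^sub>R X + d *\<^sub>R Y)"
proof -
  have "Z \<in> span {X, Y} \<longleftrightarrow> (\<exists>c d. Z - c *\<^sub>R X = d *\<^sub>R Y)"
    by (auto simp: span_insert span_singleton)
  then show ?thesis by (simp add: diff_eq_eq add.commute)
qed

text \<open>The quadratic is \<open>det (II - \<kappa> I)\<close>, where \<open>I\<close> and \<open>II\<close> are the Gram matrices of the inner
  product and of \<open>(Z, Z') \<mapsto> W Z \<bullet> Z'\<close> in the basis \<open>X, Y\<close>.\<close>

lemma eigenvalues_in_basis:
  fixes X Y :: "'a::real_inner" and W :: "'a \<Rightarrow> 'a"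
  assumes T: "T = span {X, Y}"
    and lin: "\<And>c d. W (c *\<^sub>R X + d *\<^sub>R Y) = c *\<^sub>R W X + d *\<^sub>R W Y"
    and sym: "W X \<bullet> Y = W Y \<bullet> X"
    and D: "D = (X \<bullet> X) * (Y \<bullet> Y) - (X \<bullet> Y)\<^sup>2" "0 < D"
    and S: "S = (W X \<bullet> X) * (Y \<bullet> Y) - 2 * (W X \<bullet> Y) * (X \<bullet> Y) + (W Y \<bullet> Y) * (X \<bullet> X)"
    and K: "K = (W X \<bullet> X) * (W Y \<bullet> Y) - (W X \<bullet> Y)\<^sup>2"
  shows "{\<kappa>. \<exists>Z\<in>T. Z \<noteq> 0 \<and> (\<forall>Z'\<in>T. W Z \<bullet> Z' = \<kappa> * (Z \<bullet> Z'))}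
      = {\<kappa>. D * \<kappa>\<^sup>2 - S * \<kappa> + K = 0}"
    and "4 * D * K \<le> S\<^sup>2"
proof -
  define E F G where "E = X \<bullet> X" and "F = X \<bullet> Y" and "G = Y \<bullet> Y"
  define L M N where "L = W X \<bullet> X" and "M = W X \<bullet> Y" and "N = W Y \<bullet> Y"
  note fs = E_def F_def G_def L_def M_def N_def
  have F': "Y \<bullet> X = F" and M': "W Y \<bullet> X = M" using sym by (simp_all add: fs inner_commute)
  have D': "D = E * G - F\<^sup>2" and S': "S = L * G - 2 * M * F + N * E" and K': "K = L * N - M\<^sup>2"
    using D S K by (simp_all add: fs)
  have det: "D * \<kappa>\<^sup>2 - S * \<kappa> + K = (L - \<kappa> * E) * (N - \<kappa> * G) - (M - \<kappa> * F)\<^sup>2" for \<kappa>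
    unfolding D' S' K' by algebra
  have eig: "(\<forall>Z'\<in>T. W (c *\<^sub>R X + d *\<^sub>R Y) \<bullet> Z' = \<kappa> * ((c *\<^sub>R X + d *\<^sub>R Y) \<bullet> Z')) \<longleftrightarrow>
      c * (L - \<kappa> * E) + d * (M - \<kappa> * F) = 0 \<and> c * (M - \<kappa> * F) + d * (N - \<kappa> * G) = 0"
    (is "?l \<longleftrightarrow> ?r") for c d \<kappa>
  proof -
    let ?Z = "c *\<^sub>R X + d *\<^sub>R Y"
    have "?l \<longleftrightarrow> W ?Z \<bullet> X = \<kappa> * (?Z \<bullet> X) \<and> W ?Z \<bullet> Y = \<kappa> * (?Z \<bullet> Y)"
    proof (intro iffI conjI ballI)
      assume l: ?l
      have "X \<in> T" "Y \<in> T" unfolding T by (auto intro: span_base)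
      then show "W ?Z \<bullet> X = \<kappa> * (?Z \<bullet> X)" "W ?Z \<bullet> Y = \<kappa> * (?Z \<bullet> Y)" using l by blast+
    next
      assume r: "W ?Z \<bullet> X = \<kappa> * (?Z \<bullet> X) \<and> W ?Z \<bullet> Y = \<kappa> * (?Z \<bullet> Y)"
      fix Z' assume "Z' \<in> T"
      then obtain c' d' where Z': "Z' = c' *\<^sub>R X + d' *\<^sub>R Y" unfolding T in_span_pair by blast
      show "W ?Z \<bullet> Z' = \<kappa> * (?Z \<bullet> Z')"
        unfolding Z' inner_add_right[of "W ?Z"] inner_add_right[of ?Z] inner_scaleR_right
        using r by (simp add: algebra_simps)
    qed
    also have "W ?Z \<bullet> X = \<kappa> * (?Z \<bullet> X) \<longleftrightarrow> c * (L - \<kappa> * E) + d * (M - \<kappa> * F) = 0"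
      unfolding lin by (simp add: inner_add_left M' F' flip: fs) (simp add: algebra_simps; linarith)
    also have "W ?Z \<bullet> Y = \<kappa> * (?Z \<bullet> Y) \<longleftrightarrow> c * (M - \<kappa> * F) + d * (N - \<kappa> * G) = 0"
      unfolding lin by (simp add: inner_add_left M' F' flip: fs) (simp add: algebra_simps; linarith)
    finally show ?thesis .
  qed
  have nz: "c *\<^sub>R X + d *\<^sub>R Y = 0 \<longleftrightarrow> c = 0 \<and> d = 0" for c d
    using gram_combination_eq_0[of X Y c d] D by auto
  have "(\<exists>Z\<in>T. Z \<noteq> 0 \<and> (\<forall>Z'\<in>T. W Z \<bullet> Z' = \<kappa> * (Z \<bullet> Z'))) \<longleftrightarrow> D * \<kappa>\<^sup>2 - S * \<kappa> + K = 0"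
    (is "?l \<longleftrightarrow> ?r") for \<kappa>
  proof -
    have bex_pair: "(\<exists>Z\<in>span {X, Y}. Q Z) \<longleftrightarrow> (\<exists>c d. Q (c *\<^sub>R X + d *\<^sub>R Y))" for Q
      unfolding Bex_def in_span_pair by blast
    have "?l \<longleftrightarrow> (\<exists>c d. (c \<noteq> 0 \<or> d \<noteq> 0) \<and>
        c * (L - \<kappa> * E) + d * (M - \<kappa> * F) = 0 \<and> c * (M - \<kappa> * F) + d * (N - \<kappa> * G) = 0)"
      (is "_ \<longleftrightarrow> ?m")
    proof -
      have "?l \<longleftrightarrow> (\<exists>c d. c *\<^sub>R X + d *\<^sub>R Y \<noteq> 0 \<and>
          (\<forall>Z'\<in>T. W (c *\<^sub>R X + d *\<^sub>R Y) \<bullet> Z' = \<kappa> * ((c *\<^sub>R X + d *\<^sub>R Y) \<bullet> Z')))"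
        using bex_pair by (simp add: T)
      then show ?thesis by (simp only: eig nz de_Morgan_conj)
    qed
    also have "?m \<longleftrightarrow> (L - \<kappa> * E) * (N - \<kappa> * G) - (M - \<kappa> * F)\<^sup>2 = 0"
    proof
      assume ?m
      then obtain c d where cd: "c \<noteq> 0 \<or> d \<noteq> 0"
        "c * (L - \<kappa> * E) + d * (M - \<kappa> * F) = 0" "c * (M - \<kappa> * F) + d * (N - \<kappa> * G) = 0"
        by blast
      from cd(2,3) have "c * ((L - \<kappa> * E) * (N - \<kappa> * G) - (M - \<kappa> * F)\<^sup>2) = 0"
        "d * ((L - \<kappa> * E) * (N - \<kappa> * G) - (M - \<kappa> * F)\<^sup>2) = 0" by algebra+
      then show "(L - \<kappa> * E) * (N - \<kappa> * G) - (M - \<kappa> * F)\<^sup>2 = 0" using cd(1) by auto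
    next
      assume 0: "(L - \<kappa> * E) * (N - \<kappa> * G) - (M - \<kappa> * F)\<^sup>2 = 0"
      show ?m
      proof (cases "L - \<kappa> * E = 0 \<and> M - \<kappa> * F = 0")
        case True
        then show ?thesis by (intro exI[of _ 1] exI[of _ 0]) simp
      next
        case False
        \<comment> \<open>The witness is orthogonal to the first row of the singular matrix; the
          vanishing determinant makes it orthogonal to the second row as well.\<close>
        then show ?thesis using 0
          by (intro exI[of _ "- (M - \<kappa> * F)"] exI[of _ "L - \<kappa> * E"])
            (auto simp: power2_eq_square algebra_simps)
      qed
    qed
    finally show ?thesis unfolding det .
  qed
  then show "{\<kappa>. \<exists>Z\<in>T. Z \<noteq> 0 \<and> (\<forall>Z'\<in>T. W Z \<bullet> Z' = \<kappa> * (Z \<bullet> Z'))}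
      = {\<kappa>. D * \<kappa>\<^sup>2 - S * \<kappa> + K = 0}" by blast
  have "E \<noteq> 0"
  proof
    assume "E = 0"
    then have "X = 0" by (simp add: E_def)
    then show False using D by simp
  qed
  \<comment> \<open>The discriminant as a sum of squares: E M - F L comes from eliminating between
    the two Gram matrices, and completing the square introduces the denominator E, which the factor
    \<open>E\<^sup>2\<close> clears. The coefficient 4 D is positive.\<close>
  have "E\<^sup>2 * (S\<^sup>2 - 4 * D * K)
      = 4 * D * (E * M - F * L)\<^sup>2 + (E * (E * N - G * L) - 2 * F * (E * M - F * L))\<^sup>2"
    unfolding D' S' K' by algebra
  then have "0 \<le> E\<^sup>2 * (S\<^sup>2 - 4 * D * K)" using D(2) by simp
  then show "4 * D * K \<le> S\<^sup>2" using \<open>E \<noteq> 0\<close> by (simp add: zero_le_mult_iff)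
qed

section \<open>Second-order test at a minimum, and frames containing a unit normal\<close>

lemma local_min_derivatives:
  fixes g m :: "real \<Rightarrow> real"
  assumes \<delta>: "0 < \<delta>"
    and g: "\<And>s. \<bar>s\<bar> < \<delta> \<Longrightarrow> (g has_real_derivative m s) (at s)"
    and m: "(m has_real_derivative c) (at 0)"
    and min: "\<And>s. \<bar>s\<bar> < \<delta> \<Longrightarrow> g 0 \<le> g s"
  shows "m 0 = 0" "0 \<le> c"
proof -
  show m0: "m 0 = 0"
    by (rule DERIV_local_min[OF g[of 0] \<delta>]) (use \<delta> min in auto)
  show "0 \<le> c"
  proof (rule ccontr)
    assume "\<not> 0 \<le> c"
    \<comment> \<open>A negative second derivative makes \<open>m\<close> negative immediately to
      the right of 0, since \<open>m 0 = 0\<close>; the mean value theorem then pushes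
      \<open>g\<close> below its minimum.\<close>
    then obtain e where e: "0 < e" "\<And>h. 0 < h \<Longrightarrow> h < e \<Longrightarrow> m (0 + h) < m 0"
      using DERIV_neg_dec_right[OF m] by auto
    define h where "h = min e \<delta> / 2"
    have h: "0 < h" "h < e" "h < \<delta>" using e \<delta> by (auto simp: h_def)
    obtain s where s: "0 < s" "s < h" "g h - g 0 = (h - 0) * m s"
      using MVT2[OF h(1), of g m] g h by force
    have "m s < 0" using e(2)[of s] s h m0 by simp
    then have "h * m s < 0" using h(1) by (simp add: mult_pos_neg)
    then have "g h < g 0" using s(3) by simp
    then show False using min[of h] h by simp
  qed
qed

text \<open>One frame matrix times the transpose of the other is the table of inner products. Its
  last row is (0, 0, 1), so only the upper 2 by 2 block remains, whatever the normal components of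
  p' and q' are. With p' = p and q' = q it measures the frame itself; with the vectors moved to
  depth t it yields the Jacobian of the normal map.\<close>

lemma det_unit_normal:
  fixes p q p' q' n :: "real^3"
  assumes "n \<bullet> n = 1" "n \<bullet> p = 0" "n \<bullet> q = 0"
  shows "det (vector [p', q', n] :: real^3^3) * det (vector [p, q, n] :: real^3^3) =
    (p' \<bullet> p) * (q' \<bullet> q) - (p' \<bullet> q) * (q' \<bullet> p)"
proof -
  let ?A = "vector [p', q', n] :: real^3^3" and ?B = "vector [p, q, n] :: real^3^3"
  have e: "(?A ** transpose ?B) $ i $ j = ?A $ i \<bullet> ?B $ j" for i j
    by (simp add: matrix_matrix_mult_def transpose_def inner_vec_def)
  have "det ?A * det ?B = det (?A ** transpose ?B)" by (simp add: det_mul)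
  also have "\<dots> = (p' \<bullet> p) * (q' \<bullet> q) - (p' \<bullet> q) * (q' \<bullet> p)"
    using assms unfolding det_3 e by simp
  finally show ?thesis .
qed

text \<open>Removing the normal component of z leaves a vector orthogonal to all three rows of the
  frame matrix, which \<open>det_unit_normal\<close> shows to be invertible.\<close>

lemma parallel_unit_normal:
  fixes p q n z :: "real^3"
  assumes n: "n \<bullet> n = 1" "n \<bullet> p = 0" "n \<bullet> q = 0"
    and D: "(p \<bullet> p) * (q \<bullet> q) - (p \<bullet> q)\<^sup>2 \<noteq> 0"
    and z: "z \<bullet> p = 0" "z \<bullet> q = 0"
  shows "z = (z \<bullet> n) *\<^sub>R n"
proof -
  let ?A = "vector [p, q, n] :: real^3^3"
  define r where "r = z - (z \<bullet> n) *\<^sub>R n"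
  have "det ?A \<noteq> 0"
    using det_unit_normal[OF n, of p q] D by (auto simp: power2_eq_square inner_commute)
  moreover have "?A *v r = 0"
  proof -
    have "?A $ i \<bullet> r = 0" for i
      using exhaust_3[of i] n z
      by (auto simp: r_def inner_diff_right inner_commute)
    then show ?thesis by (simp add: vec_eq_iff matrix_vector_mul_component)
  qed
  ultimately have "r = 0"
    using invertible_det_nz[of ?A] matrix_left_invertible_ker[of ?A] unfolding invertible_def by blast
  then show ?thesis by (simp add: r_def)
qed

text \<open>A chart point and a depth are stored together as one vector of \<open>real^3\<close>, so
  that the normal map goes from \<open>real^3\<close> to itself and its derivative has a matrix
  determinant. This is the projection that forgets the depth.\<close>

definition base :: "real^3 \<Rightarrow> real^2" where "base z = vector [z $ 1, z $ 2]"

lemma linear_base: "linear base"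
  by (rule linearI) (simp_all add: base_def vec_eq_iff forall_2)

text \<open>This is the chain rule for the transition map. The point is the order of quantifiers: J
  is fixed before h, so it serves \<open>f\<close> and \<nu> at once, which is why d\<nu> is well
  defined as a function of df.\<close>

lemma chart_change_derivative:
  fixes P :: "'m::t2_space atlas"
  assumes cs: "closed_surface P" and c: "(U, \<phi>) \<in> P" "u \<in> U" "(V, \<psi>) \<in> P" "v \<in> V"
    and eq: "\<psi> v = \<phi> u"
  obtains J where "\<And>h::'m \<Rightarrow> 'b::real_normed_vector. smooth_map P h \<Longrightarrow>
    frechet_derivative (h \<circ> \<psi>) (at v) = frechet_derivative (h \<circ> \<phi>) (at u) \<circ> J"
proof -
  note cU = chart_facts[OF cs c(1)] and cV = chart_facts[OF cs c(3)]
  define \<tau> where "\<tau> = inv_into U \<phi> \<circ> \<psi>"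
  define W where "W = V \<inter> \<psi> -` (\<phi> ` U)"
  have W: "open W" "v \<in> W"
    unfolding W_def using continuous_open_preimage[OF cV(3) cV(1) cU(2)] c eq by auto
  have "smooth_on W \<tau>"
  proof -
    have "\<forall>(U, \<phi>)\<in>P. \<forall>(V, \<psi>)\<in>P. smooth_on (U \<inter> \<phi> -` (\<psi> ` V)) (inv_into V \<psi> \<circ> \<phi>)"
      using cs by (simp add: closed_surface_def smooth_atlas_def)
    from bspec[OF this c(3)] have
      "\<forall>(U, \<phi>)\<in>P. smooth_on (V \<inter> \<psi> -` (\<phi> ` U)) (inv_into U \<phi> \<circ> \<psi>)" by simp
    from bspec[OF this c(1)] show ?thesis by (simp add: W_def \<tau>_def)
  qed
  then have \<tau>: "(\<tau> has_derivative frechet_derivative \<tau> (at v)) (at v)"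
    using W(2) by (rule smooth_on_has_derivative)
  have \<tau>v: "\<tau> v = u" using cU(4) c(2) eq by (simp add: \<tau>_def inv_into_f_f)
  show ?thesis
  proof (rule that[of "frechet_derivative \<tau> (at v)"])
    fix h :: "'m \<Rightarrow> 'b" assume "smooth_map P h"
    then have "smooth_on U (h \<circ> \<phi>)" using c(1) unfolding smooth_map_def by fast
    from smooth_on_has_derivative[OF this c(2)]
    have "((h \<circ> \<phi>) \<circ> \<tau> has_derivative
        frechet_derivative (h \<circ> \<phi>) (at u) \<circ> frechet_derivative \<tau> (at v)) (at v)"
      by (intro diff_chain_at \<tau>) (simp add: \<tau>v)
    then have "(h \<circ> \<psi> has_derivative
        frechet_derivative (h \<circ> \<phi>) (at u) \<circ> frechet_derivative \<tau> (at v)) (at v)"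
      by (rule has_derivative_transform_within_open[OF _ W])
        (auto simp: W_def \<tau>_def f_inv_into_f)
    then show "frechet_derivative (h \<circ> \<psi>) (at v) =
        frechet_derivative (h \<circ> \<phi>) (at u) \<circ> frechet_derivative \<tau> (at v)"
      by (rule frechet_derivative_at[symmetric])
  qed
qed

section \<open>Integration over normal segments\<close>

lemma prod_Basis_vec:
  fixes h :: "real^'n \<Rightarrow> 'b::comm_monoid_mult"
  shows "(\<Prod>b\<in>Basis. h b) = (\<Prod>i\<in>UNIV. h (axis i 1))"
proof -
  have "Basis = range (\<lambda>i. axis i (1::real) :: real^'n)" by (auto simp: Basis_vec_def)
  moreover have "inj (\<lambda>i. axis i (1::real) :: real^'n)" by (simp add: inj_def axis_eq_axis)
  ultimately show ?thesis by (metis (no_types, lifting) prod.reindex_cong)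
qed

text \<open>Both measures agree on boxes, because the preimage of a box under the reassembling map
  is a planar box times an interval. It prepares the integration over the depth with the chart point
  held fixed.\<close>

lemma lborel_real3:
  "(lborel :: (real^3) measure) =
    distr lborel borel (\<lambda>p :: (real^2) \<times> real. vector [fst p $ 1, fst p $ 2, snd p])"
  (is "_ = distr _ _ ?j")
proof (rule lborel_eqI)
  have "linear ?j" by (rule linearI) (simp_all add: vec_eq_iff forall_3)
  then have j: "?j \<in> borel_measurable borel"
    by (intro borel_measurable_continuous_onI linear_continuous_on) (simp add: linear_linear)
  fix l u :: "real^3" assume le: "\<And>b. b \<in> Basis \<Longrightarrow> l \<bullet> b \<le> u \<bullet> b"
  have le_nth: "l $ i \<le> u $ i" for i
    using le[of "axis i 1"] by (simp add: inner_axis axis_in_Basis_iff)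
  have pre: "?j -` box l u = box (base l) (base u) \<times> box (l $ 3) (u $ 3)"
    by (auto simp: mem_box_cart forall_3 forall_2 base_def box_real)
  have "emeasure (distr lborel borel ?j) (box l u) = emeasure lborel (?j -` box l u)"
    using j by (subst emeasure_distr) auto
  also have "\<dots> = emeasure (lborel \<Otimes>\<^sub>M lborel) (box (base l) (base u) \<times> box (l $ 3) (u $ 3))"
    unfolding pre lborel_prod ..
  also have "\<dots> = emeasure lborel (box (base l) (base u)) * emeasure lborel (box (l $ 3) (u $ 3))"
    by (rule lborel.emeasure_pair_measure_Times) auto
  also have "emeasure lborel (box (base l) (base u)) = ennreal ((u $ 1 - l $ 1) * (u $ 2 - l $ 2))"
  proof (subst emeasure_lborel_box)
    fix b :: "real^2" assume "b \<in> Basis"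
    then obtain i where "b = axis i 1" by (auto simp: Basis_vec_def)
    then show "base l \<bullet> b \<le> base u \<bullet> b"
      using le_nth exhaust_2[of i] by (auto simp: inner_axis base_def)
  qed (simp add: prod_Basis_vec inner_axis UNIV_2 base_def)
  also have "emeasure lborel (box (l $ 3) (u $ 3)) = ennreal (u $ 3 - l $ 3)"
    using le_nth by (simp add: box_real)
  also have "ennreal ((u $ 1 - l $ 1) * (u $ 2 - l $ 2)) * ennreal (u $ 3 - l $ 3) =
      ennreal (\<Prod>b\<in>Basis. (u - l) \<bullet> b)"
  proof (subst ennreal_mult[symmetric])
    have "(\<Prod>b\<in>Basis. (u - l) \<bullet> b) = (u $ 1 - l $ 1) * ((u $ 2 - l $ 2) * (u $ 3 - l $ 3))"
      unfolding prod_Basis_vec UNIV_3 by (simp add: inner_axis)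
    then show "ennreal ((u $ 1 - l $ 1) * (u $ 2 - l $ 2) * (u $ 3 - l $ 3)) =
        ennreal (\<Prod>b\<in>Basis. (u - l) \<bullet> b)"
      by (simp only: mult.assoc)
  qed (use le_nth[of 1] le_nth[of 2] le_nth[of 3] in auto)
  finally show "emeasure (distr lborel borel ?j) (box l u) = ennreal (\<Prod>b\<in>Basis. (u - l) \<bullet> b)" .
qed simp

lemma nn_integral_real3:
  fixes g :: "real^3 \<Rightarrow> ennreal"
  assumes g: "g \<in> borel_measurable borel"
  shows "(\<integral>\<^sup>+z. g z \<partial>lborel) =
    (\<integral>\<^sup>+(u::real^2). \<integral>\<^sup>+t. g (vector [u $ 1, u $ 2, t]) \<partial>lborel \<partial>lborel)"
proof -
  let ?j = "\<lambda>p :: (real^2) \<times> real. vector [fst p $ 1, fst p $ 2, snd p] :: real^3"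
  have "linear ?j" by (rule linearI) (simp_all add: vec_eq_iff forall_3)
  then have j: "?j \<in> borel_measurable borel"
    by (intro borel_measurable_continuous_onI linear_continuous_on) (simp add: linear_linear)
  have gj: "(\<lambda>p. g (?j p)) \<in> borel_measurable (lborel \<Otimes>\<^sub>M lborel)"
    unfolding lborel_prod using measurable_compose[OF j g] by simp
  have "(\<integral>\<^sup>+z. g z \<partial>lborel) = (\<integral>\<^sup>+p. g (?j p) \<partial>lborel)"
    using j g by (subst lborel_real3) (simp add: nn_integral_distr)
  also have "\<dots> = (\<integral>\<^sup>+p. g (?j p) \<partial>(lborel \<Otimes>\<^sub>M lborel))" unfolding lborel_prod ..
  also have "\<dots> = (\<integral>\<^sup>+(u::real^2). \<integral>\<^sup>+t. g (vector [u $ 1, u $ 2, t]) \<partial>lborel \<partial>lborel)"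
    by (simp only: lborel.nn_integral_fst[OF gj, symmetric] fst_conv snd_conv)
  finally show ?thesis .
qed

text \<open>On the interval, b t \<le> a t \<le> 1, so both factors are nonnegative even if b is
  negative, and the absolute value disappears. The right-hand side is the value of a cubic
  antiderivative at 1 / a.\<close>

lemma nn_integral_tube_fibre:
  fixes a b :: real
  assumes "0 < a" "b \<le> a"
  shows "(\<integral>\<^sup>+t. ennreal \<bar>(1 - a * t) * (1 - b * t)\<bar> * indicator {0..1 / a} t \<partial>lborel) =
    ennreal ((3 * a - b) / (6 * a\<^sup>2))"
proof -
  have pos: "0 \<le> (1 - a * t) * (1 - b * t)" if "0 \<le> t" "t \<le> 1 / a" for t
  proof -
    have "a * t \<le> 1" using that(2) assms(1) by (simp add: field_simps)
    moreover have "b * t \<le> a * t" using assms(2) that(1) by (rule mult_right_mono)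
    ultimately show ?thesis by simp
  qed
  let ?F = "\<lambda>t. t - (a + b) / 2 * t\<^sup>2 + a * b / 3 * t ^ 3"
  have "(\<integral>\<^sup>+t. ennreal \<bar>(1 - a * t) * (1 - b * t)\<bar> * indicator {0..1 / a} t \<partial>lborel) =
      (\<integral>\<^sup>+t. ennreal ((1 - a * t) * (1 - b * t)) * indicator {0..1 / a} t \<partial>lborel)"
    using pos by (intro nn_integral_cong) (auto simp: indicator_def)
  also have "\<dots> = ennreal (?F (1 / a) - ?F 0)"
  proof (rule nn_integral_FTC_Icc)
    show "(?F has_real_derivative (1 - a * t) * (1 - b * t)) (at t)" for t
      by (auto intro!: derivative_eq_intros simp: power2_eq_square algebra_simps)
  qed (use assms pos in auto)
  also have "?F (1 / a) - ?F 0 = (3 * a - b) / (6 * a\<^sup>2)"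
    using assms(1) by (simp add: power2_eq_square power3_eq_cube field_simps)
  finally show ?thesis .
qed

text \<open>The antiderivative formula holds for either sign of w because the integral is oriented;
  the application is at w = - u, to the inside of the surface.\<close>

lemma interval_integral_quadratic:
  fixes a b w :: real
  shows "(LBINT t=0..ereal w. (1 + a * t) * (1 + b * t)) = w + (a + b) / 2 * w\<^sup>2 + a * b / 3 * w ^ 3"
proof -
  let ?F = "\<lambda>t. t + (a + b) / 2 * t\<^sup>2 + a * b / 3 * t ^ 3"
  have "(LBINT t=ereal 0..ereal w. (1 + a * t) * (1 + b * t)) = ?F w - ?F 0"
  proof (rule interval_integral_FTC_finite)
    show "(?F has_vector_derivative (1 + a * t) * (1 + b * t)) (at t within {min 0 w..max 0 w})" for t
      unfolding has_real_derivative_iff_has_vector_derivative[symmetric]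
      by (auto intro!: derivative_eq_intros simp: power2_eq_square algebra_simps)
  qed (intro continuous_intros)
  then show ?thesis by (simp add: zero_ereal_def)
qed

section \<open>Curvature in charts\<close>

locale enclosing_surface =
  fixes P :: "'m::t2_space atlas" and f \<nu> :: "'m \<Rightarrow> real^3" and \<Omega> :: "(real^3) set"
  assumes closed: "closed_surface P"
    and embedding: "smooth_embedding P f"
    and encloses: "encloses f \<Omega>"
    and normal: "outward_unit_normal P f \<Omega> \<nu>"
    and mean_convex: "mean_convex P f \<nu>"
begin

abbreviation "dF \<phi> u \<equiv> frechet_derivative (f \<circ> \<phi>) (at u)"
abbreviation "dN \<phi> u \<equiv> frechet_derivative (\<nu> \<circ> \<phi>) (at u)"
abbreviation "\<kappa>\<^sub>1 \<equiv> lambda1 P f \<nu>"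
abbreviation "\<kappa>\<^sub>2 \<equiv> lambda2 P f \<nu>"
abbreviation "T \<equiv> tangent_plane P f"
abbreviation "W \<equiv> normal_derivative P f \<nu>"
abbreviation "\<mu> \<equiv> area_measure P f"

lemma smooth_maps: "smooth_map P f" "smooth_map P \<nu>"
  using embedding normal by (auto simp: smooth_embedding_def outward_unit_normal_def)

lemma smooth_charts:
  assumes "(U, \<phi>) \<in> P"
  shows "smooth_on U (f \<circ> \<phi>)" "smooth_on U (\<nu> \<circ> \<phi>)"
  using smooth_maps assms unfolding smooth_map_def by fast+

lemma chart_derivatives:
  assumes "(U, \<phi>) \<in> P" "u \<in> U"
  shows "(f \<circ> \<phi> has_derivative dF \<phi> u) (at u)" "(\<nu> \<circ> \<phi> has_derivative dN \<phi> u) (at u)"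
    "linear (dF \<phi> u)" "linear (dN \<phi> u)"
proof -
  show "(f \<circ> \<phi> has_derivative dF \<phi> u) (at u)" "(\<nu> \<circ> \<phi> has_derivative dN \<phi> u) (at u)"
    using smooth_charts[OF assms(1)] assms(2) by (simp_all add: smooth_on_has_derivative)
  then show "linear (dF \<phi> u)" "linear (dN \<phi> u)" by (simp_all add: has_derivative_linear)
qed

lemma dF_inj: "(U, \<phi>) \<in> P \<Longrightarrow> u \<in> U \<Longrightarrow> inj (dF \<phi> u)"
  using embedding unfolding smooth_embedding_def by fast

lemma chart_at:
  obtains U \<phi> u where "(U, \<phi>) \<in> P" "u \<in> U" "\<phi> u = x"
proof -
  have "x \<in> (\<Union>(U, \<phi>)\<in>P. \<phi> ` U)"
    using closed by (simp add: closed_surface_def smooth_atlas_def)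
  then show ?thesis using that by auto
qed

text \<open>The definition ranges over all charts through the point; a change of chart shows that
  any single one already gives the whole plane.\<close>

lemma tangent_plane_eq:
  assumes c: "(U, \<phi>) \<in> P" "u \<in> U"
  shows "T (\<phi> u) = range (dF \<phi> u)"
proof
  show "range (dF \<phi> u) \<subseteq> T (\<phi> u)" using c unfolding tangent_plane_def by fast
  show "T (\<phi> u) \<subseteq> range (dF \<phi> u)"
  proof
    fix X assume "X \<in> T (\<phi> u)"
    then obtain V \<psi> v a where v: "(V, \<psi>) \<in> P" "v \<in> V" "\<psi> v = \<phi> u" "X = dF \<psi> v a"
      unfolding tangent_plane_def by auto
    obtain J where "dF \<psi> v = dF \<phi> u \<circ> J"
      using chart_change_derivative[OF closed c v(1-3)] smooth_maps(1) by metis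
    then show "X \<in> range (dF \<phi> u)" using v(4) by simp
  qed
qed

text \<open>Uniqueness in the definite description: another chart produces df and d\<nu> with the
  same J, and injectivity of df forces the two direction vectors to correspond under J.\<close>

lemma normal_derivative_eq:
  assumes c: "(U, \<phi>) \<in> P" "u \<in> U"
  shows "W (\<phi> u) (dF \<phi> u a) = dN \<phi> u a"
  unfolding normal_derivative_def
proof (rule the_equality)
  show "\<exists>(V, \<psi>)\<in>P. \<exists>v\<in>V. \<exists>b. \<psi> v = \<phi> u \<and> dF \<phi> u a = dF \<psi> v b \<and> dN \<phi> u a = dN \<psi> v b"
    using c by fast
next
  fix Z
  assume "\<exists>(V, \<psi>)\<in>P. \<exists>v\<in>V. \<exists>b. \<psi> v = \<phi> u \<and> dF \<phi> u a = dF \<psi> v b \<and> Z = dN \<psi> v b"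
  then obtain V \<psi> v b where v: "(V, \<psi>) \<in> P" "v \<in> V" "\<psi> v = \<phi> u"
    and b: "dF \<phi> u a = dF \<psi> v b" "Z = dN \<psi> v b" by auto
  obtain J where J: "dF \<psi> v = dF \<phi> u \<circ> J" "dN \<psi> v = dN \<phi> u \<circ> J"
    using chart_change_derivative[OF closed c v] smooth_maps by metis
  have "a = J b" using b(1) dF_inj[OF c] by (simp add: J inj_eq)
  then show "Z = dN \<phi> u a" using b(2) J by simp
qed

lemma normal_orthogonal:
  assumes "(U, \<phi>) \<in> P" "u \<in> U"
  shows "\<nu> (\<phi> u) \<bullet> dF \<phi> u a = 0"
proof -
  have "dF \<phi> u a \<in> T (\<phi> u)" using tangent_plane_eq[OF assms] by simp
  then show ?thesis using normal by (simp add: outward_unit_normal_def)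
qed

lemma norm_normal: "norm (\<nu> x) = 1"
  using normal by (simp add: outward_unit_normal_def)

lemma second_derivative:
  assumes c: "(U, \<phi>) \<in> P" "u \<in> U"
  shows "((\<lambda>y. dF \<phi> y v) has_derivative frechet_derivative (\<lambda>y. dF \<phi> y v) (at u)) (at u)"
  by (rule smooth_on_has_derivative[OF smooth_on_frechet_derivative[OF smooth_charts(1)[OF c(1)]] c(2)])

text \<open>Differentiating the constant function \<open>\<nu> \<bullet> dF w\<close> = 0 along v
  moves the derivative from \<nu> to \<open>f\<close>. Both the symmetry and the second-order
  condition at a nearest point are read off in this form.\<close>

lemma second_ff_second_derivative:
  assumes c: "(U, \<phi>) \<in> P" "u \<in> U"
  shows "dN \<phi> u v \<bullet> dF \<phi> u w = - (\<nu> (\<phi> u) \<bullet> frechet_derivative (\<lambda>y. dF \<phi> y w) (at u) v)"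
proof -
  let ?H = "frechet_derivative (\<lambda>y. dF \<phi> y w) (at u)"
  have "((\<lambda>y. (\<nu> \<circ> \<phi>) y \<bullet> dF \<phi> y w) has_derivative
      (\<lambda>h. (\<nu> \<circ> \<phi>) u \<bullet> ?H h + dN \<phi> u h \<bullet> dF \<phi> u w)) (at u)"
    by (intro has_derivative_inner chart_derivatives[OF c] second_derivative[OF c])
  moreover have "((\<lambda>y. (\<nu> \<circ> \<phi>) y \<bullet> dF \<phi> y w) has_derivative (\<lambda>h. 0)) (at u)"
    by (rule has_derivative_transform_within_open[OF has_derivative_const[of 0]
          chart_facts(1)[OF closed c(1)] c(2)]) (simp add: normal_orthogonal[OF c(1)])
  ultimately have "(\<lambda>h. (\<nu> \<circ> \<phi>) u \<bullet> ?H h + dN \<phi> u h \<bullet> dF \<phi> u w) = (\<lambda>h. 0)"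
    by (rule has_derivative_unique)
  from fun_cong[OF this, of v] show ?thesis by simp
qed

text \<open>Up to sign the form is the second derivative at u of a real-valued height function,
  \<open>f\<close> paired with the normal frozen at u, and second derivatives commute.\<close>

lemma second_ff_symmetric:
  assumes c: "(U, \<phi>) \<in> P" "u \<in> U"
  shows "dN \<phi> u a \<bullet> dF \<phi> u b = dN \<phi> u b \<bullet> dF \<phi> u a"
proof -
  define H where "H v y = frechet_derivative (\<lambda>y. dF \<phi> y v) (at y)" for v y
  have H: "((\<lambda>y. dF \<phi> y v) has_derivative H v y) (at y)" if "y \<in> U" for v y
    unfolding H_def by (rule second_derivative[OF c(1) that])
  have contH: "continuous_on U (\<lambda>y. H v y w)" for v w
    unfolding H_def
    by (intro smooth_on_continuous_derivative smooth_on_frechet_derivative smooth_charts(1)[OF c(1)])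
  have "H a u b \<bullet> \<nu> (\<phi> u) = H b u a \<bullet> \<nu> (\<phi> u)"
  proof (rule second_derivative_symmetric[OF chart_facts(1)[OF closed c(1)] c(2),
        where G = "\<lambda>y. (f \<circ> \<phi>) y \<bullet> \<nu> (\<phi> u)"
        and G' = "\<lambda>y v. dF \<phi> y v \<bullet> \<nu> (\<phi> u)" and A = "\<lambda>y w. H a y w \<bullet> \<nu> (\<phi> u)"
        and B = "\<lambda>y w. H b y w \<bullet> \<nu> (\<phi> u)"])
    fix y assume y: "y \<in> U"
    show "((\<lambda>y. (f \<circ> \<phi>) y \<bullet> \<nu> (\<phi> u)) has_derivative (\<lambda>v. dF \<phi> y v \<bullet> \<nu> (\<phi> u))) (at y)"
      by (intro has_derivative_inner_left chart_derivatives[OF c(1) y])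
    show "((\<lambda>y. dF \<phi> y a \<bullet> \<nu> (\<phi> u)) has_derivative (\<lambda>w. H a y w \<bullet> \<nu> (\<phi> u))) (at y)"
      "((\<lambda>y. dF \<phi> y b \<bullet> \<nu> (\<phi> u)) has_derivative (\<lambda>w. H b y w \<bullet> \<nu> (\<phi> u))) (at y)"
      by (intro has_derivative_inner_left H y)+
  qed (intro continuous_intros contH)+
  then show ?thesis
    unfolding second_ff_second_derivative[OF c] H_def by (simp add: inner_commute)
qed

lemma normal_derivative_linear:
  assumes "X \<in> T x" "Y \<in> T x"
  shows "W x (c *\<^sub>R X + d *\<^sub>R Y) = c *\<^sub>R W x X + d *\<^sub>R W x Y"
proof -
  obtain U \<phi> u where u: "(U, \<phi>) \<in> P" "u \<in> U" and x: "\<phi> u = x" by (rule chart_at)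
  obtain a b where ab: "X = dF \<phi> u a" "Y = dF \<phi> u b"
    using assms tangent_plane_eq[OF u] by (auto simp: x)
  have "c *\<^sub>R X + d *\<^sub>R Y = dF \<phi> u (c *\<^sub>R a + d *\<^sub>R b)"
    using chart_derivatives(3)[OF u] by (simp add: ab linear_add linear_scale)
  then show ?thesis
    using normal_derivative_eq[OF u] chart_derivatives(4)[OF u]
    by (simp add: x ab linear_add linear_scale)
qed

lemma normal_derivative_symmetric:
  assumes "X \<in> T x" "Y \<in> T x"
  shows "W x X \<bullet> Y = W x Y \<bullet> X"
proof -
  obtain U \<phi> u where u: "(U, \<phi>) \<in> P" "u \<in> U" and x: "\<phi> u = x" by (rule chart_at)
  obtain a b where ab: "X = dF \<phi> u a" "Y = dF \<phi> u b"
    using assms tangent_plane_eq[OF u] by (auto simp: x)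
  show ?thesis
    using normal_derivative_eq[OF u] second_ff_symmetric[OF u] by (simp add: x ab)
qed

text \<open>The basis is left free because two are used: the coordinate basis of a chart, for
  continuity and for the Jacobian, and an orthonormal basis, for the trace-free norm.\<close>

lemma curvatures_in_basis:
  assumes T: "T x = span {X, Y}"
    and D: "D = (X \<bullet> X) * (Y \<bullet> Y) - (X \<bullet> Y)\<^sup>2" "0 < D"
    and S: "S = (W x X \<bullet> X) * (Y \<bullet> Y) - 2 * (W x X \<bullet> Y) * (X \<bullet> Y) + (W x Y \<bullet> Y) * (X \<bullet> X)"
    and K: "K = (W x X \<bullet> X) * (W x Y \<bullet> Y) - (W x X \<bullet> Y)\<^sup>2"
  shows "\<kappa>\<^sub>1 x \<in> principal_curvatures P f \<nu> x" "\<kappa>\<^sub>2 x \<le> \<kappa>\<^sub>1 x"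
    "\<kappa>\<^sub>1 x + \<kappa>\<^sub>2 x = S / D" "\<kappa>\<^sub>1 x * \<kappa>\<^sub>2 x = K / D"
proof -
  have XY: "X \<in> T x" "Y \<in> T x" unfolding T by (auto intro: span_base)
  note e = eigenvalues_in_basis[where W = "W x", OF T normal_derivative_linear[OF XY]
      normal_derivative_symmetric[OF XY] D S K]
  have pc: "principal_curvatures P f \<nu> x = {\<kappa>. D * \<kappa>\<^sup>2 - S * \<kappa> + K = 0}"
    unfolding principal_curvatures_def second_ff_def e(1) ..
  show "\<kappa>\<^sub>1 x \<in> principal_curvatures P f \<nu> x" "\<kappa>\<^sub>2 x \<le> \<kappa>\<^sub>1 x"
    "\<kappa>\<^sub>1 x + \<kappa>\<^sub>2 x = S / D" "\<kappa>\<^sub>1 x * \<kappa>\<^sub>2 x = K / D"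
    unfolding lambda1_def lambda2_def pc using quadratic_root_set[OF D(2) e(2)] by simp_all
qed

lemma chart_basis:
  fixes U \<phi> u
  assumes c: "(U, \<phi>) \<in> P" "u \<in> U"
  defines "X \<equiv> dF \<phi> u (axis 1 1)" and "Y \<equiv> dF \<phi> u (axis 2 1)"
  shows "T (\<phi> u) = span {X, Y}" "0 < (X \<bullet> X) * (Y \<bullet> Y) - (X \<bullet> Y)\<^sup>2"
    "area_density f \<phi> u = sqrt ((X \<bullet> X) * (Y \<bullet> Y) - (X \<bullet> Y)\<^sup>2)"
proof -
  note lin = chart_derivatives(3)[OF c]
  have dF: "dF \<phi> u v = v $ 1 *\<^sub>R X + v $ 2 *\<^sub>R Y" for v
    unfolding X_def Y_def
    by (subst axis_decomp_2[of v]) (simp add: linear_add[OF lin] linear_scale[OF lin])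
  show "T (\<phi> u) = span {X, Y}"
  proof (intro equalityI subsetI)
    fix Z assume "Z \<in> T (\<phi> u)"
    then show "Z \<in> span {X, Y}" unfolding tangent_plane_eq[OF c] in_span_pair using dF by blast
  next
    fix Z assume "Z \<in> span {X, Y}"
    then obtain c' d' where "Z = c' *\<^sub>R X + d' *\<^sub>R Y" unfolding in_span_pair by blast
    then have "Z = dF \<phi> u (vector [c', d'])" unfolding dF by simp
    then show "Z \<in> T (\<phi> u)" unfolding tangent_plane_eq[OF c] by simp
  qed
  define D where "D = (X \<bullet> X) * (Y \<bullet> Y) - (X \<bullet> Y)\<^sup>2"
  have "0 \<le> D" unfolding D_def using Cauchy_Schwarz_ineq[of X Y] by simp
  moreover have "D \<noteq> 0"
  proof
    assume D0: "D = 0"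
    \<comment> \<open>Up to the factor X . X this is Y minus its projection to X. If D = 0 it
      vanishes, and injectivity of df then kills its coefficients, among them X . X.\<close>
    define Z where "Z = (X \<bullet> X) *\<^sub>R Y - (X \<bullet> Y) *\<^sub>R X"
    have "Z \<bullet> Z = (X \<bullet> X) * D"
      by (simp add: Z_def D_def inner_diff_left inner_diff_right inner_commute[of Y X]
          power2_eq_square algebra_simps)
    then have "Z = 0" using D0 by simp
    have "dF \<phi> u (vector [- (X \<bullet> Y), X \<bullet> X]) = Z" unfolding dF Z_def by simp
    also have "\<dots> = dF \<phi> u 0" using \<open>Z = 0\<close> linear_0[OF lin] by simp
    finally have "vector [- (X \<bullet> Y), X \<bullet> X] = (0 :: real^2)"
      using dF_inj[OF c] by (simp add: inj_eq)
    then have "X = 0" by (simp add: vec_eq_iff forall_2)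
    then have "dF \<phi> u (axis 1 1) = dF \<phi> u 0" using linear_0[OF lin] by (simp add: X_def)
    then have "axis 1 1 = (0 :: real^2)" using dF_inj[OF c] by (simp add: inj_eq)
    then show False by (simp add: axis_eq_0_iff)
  qed
  ultimately show "0 < (X \<bullet> X) * (Y \<bullet> Y) - (X \<bullet> Y)\<^sup>2" unfolding D_def by simp
  show "area_density f \<phi> u = sqrt ((X \<bullet> X) * (Y \<bullet> Y) - (X \<bullet> Y)\<^sup>2)"
    unfolding area_density_eq Let_def X_def Y_def
    by (simp add: inner_commute power2_eq_square)
qed

text \<open>In the classical notation for the two fundamental forms this is L G - 2 M F + N E, and
  \<open>chart_prod\<close> is L N - M^2. Divided by E G - F^2, the squared area density, they are
  twice the mean curvature \<open>E1\<close> and the Gauss curvature; both are polynomial in first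
  derivatives and hence continuous.\<close>

definition chart_sum :: "(real^2 \<Rightarrow> 'm) \<Rightarrow> real^2 \<Rightarrow> real" where
  "chart_sum \<phi> u = (let X = dF \<phi> u (axis 1 1); Y = dF \<phi> u (axis 2 1);
     X' = dN \<phi> u (axis 1 1); Y' = dN \<phi> u (axis 2 1) in
     (X' \<bullet> X) * (Y \<bullet> Y) - 2 * (X' \<bullet> Y) * (X \<bullet> Y) + (Y' \<bullet> Y) * (X \<bullet> X))"

definition chart_prod :: "(real^2 \<Rightarrow> 'm) \<Rightarrow> real^2 \<Rightarrow> real" where
  "chart_prod \<phi> u = (let X = dF \<phi> u (axis 1 1); Y = dF \<phi> u (axis 2 1);
     X' = dN \<phi> u (axis 1 1); Y' = dN \<phi> u (axis 2 1) in
     (X' \<bullet> X) * (Y' \<bullet> Y) - (X' \<bullet> Y)\<^sup>2)"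

lemma area_density_pos:
  assumes "(U, \<phi>) \<in> P" "u \<in> U"
  shows "0 < area_density f \<phi> u"
  using chart_basis[OF assms] by simp

lemma curvatures_in_chart:
  assumes c: "(U, \<phi>) \<in> P" "u \<in> U"
  shows "\<kappa>\<^sub>1 (\<phi> u) \<in> principal_curvatures P f \<nu> (\<phi> u)" "\<kappa>\<^sub>2 (\<phi> u) \<le> \<kappa>\<^sub>1 (\<phi> u)"
    "\<kappa>\<^sub>1 (\<phi> u) + \<kappa>\<^sub>2 (\<phi> u) = chart_sum \<phi> u / (area_density f \<phi> u)\<^sup>2"
    "\<kappa>\<^sub>1 (\<phi> u) * \<kappa>\<^sub>2 (\<phi> u) = chart_prod \<phi> u / (area_density f \<phi> u)\<^sup>2"
proof -
  have a: "(area_density f \<phi> u)\<^sup>2 = (dF \<phi> u (axis 1 1) \<bullet> dF \<phi> u (axis 1 1)) *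
      (dF \<phi> u (axis 2 1) \<bullet> dF \<phi> u (axis 2 1)) - (dF \<phi> u (axis 1 1) \<bullet> dF \<phi> u (axis 2 1))\<^sup>2"
    using chart_basis(2,3)[OF c] by simp
  have "0 < (area_density f \<phi> u)\<^sup>2" using area_density_pos[OF c] by simp
  note r = curvatures_in_basis[OF chart_basis(1)[OF c] a this, of "chart_sum \<phi> u" "chart_prod \<phi> u",
      unfolded normal_derivative_eq[OF c] chart_sum_def chart_prod_def Let_def, OF refl refl]
  show "\<kappa>\<^sub>1 (\<phi> u) \<in> principal_curvatures P f \<nu> (\<phi> u)" "\<kappa>\<^sub>2 (\<phi> u) \<le> \<kappa>\<^sub>1 (\<phi> u)"
    "\<kappa>\<^sub>1 (\<phi> u) + \<kappa>\<^sub>2 (\<phi> u) = chart_sum \<phi> u / (area_density f \<phi> u)\<^sup>2"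
    "\<kappa>\<^sub>1 (\<phi> u) * \<kappa>\<^sub>2 (\<phi> u) = chart_prod \<phi> u / (area_density f \<phi> u)\<^sup>2"
    unfolding chart_sum_def chart_prod_def Let_def by (rule r)+
qed

lemma lambda1_principal: "\<kappa>\<^sub>1 x \<in> principal_curvatures P f \<nu> x" and lambda2_le: "\<kappa>\<^sub>2 x \<le> \<kappa>\<^sub>1 x"
  using curvatures_in_chart by (metis chart_at)+

lemma E1_pos: "0 < E1 P f \<nu> x"
  using mean_convex by (simp add: mean_convex_def)

lemma lambda1_pos: "0 < \<kappa>\<^sub>1 x"
  using E1_pos[of x] lambda2_le[of x] by (simp add: E1_def)

text \<open>In an orthonormal basis the squared norm is a function of trace and determinant of the
  second fundamental form alone, namely half of trace^2 - 4 det, so it does not matter which basis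
  was selected.\<close>

lemma tracefree_norm_sq_eq: "tracefree_norm_sq P f \<nu> x = (\<kappa>\<^sub>1 x - \<kappa>\<^sub>2 x)\<^sup>2 / 2"
proof -
  obtain U \<phi> u where u: "(U, \<phi>) \<in> P" "u \<in> U" and x: "\<phi> u = x" by (rule chart_at)
  have lin: "linear (dF \<phi> u)" using chart_derivatives[OF u] by blast
  have Tx: "T x = range (dF \<phi> u)" using tangent_plane_eq[OF u] by (simp add: x)
  have sub: "subspace (T x)" unfolding Tx by (rule linear_subspace_image[OF lin subspace_UNIV])
  have dim: "dim (T x) = 2"
    unfolding Tx using dim_image_eq[OF lin, of UNIV] dF_inj[OF u] by simp
  define Q where "Q E \<longleftrightarrow> pairwise orthogonal E \<and> (\<forall>e\<in>E. norm e = 1) \<and> span E = T x" for E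
  \<comment> \<open>The very set selected in \<open>bilinear_norm_sq\<close>; any orthonormal basis
    of the plane shows through \<open>someI\<close> that it has the required properties.\<close>
  define E where "E = (SOME E. Q E)"
  obtain B where "pairwise orthogonal B" "\<And>x. x \<in> B \<Longrightarrow> norm x = 1" "span B = T x"
    using orthonormal_basis_subspace[OF sub] by metis
  then have "Q B" by (simp add: Q_def)
  then have E: "Q E" unfolding E_def by (rule someI)
  have "independent E" using E unfolding Q_def by (intro pairwise_orthogonal_independent) auto
  then have "card E = 2" using dim E dim_eq_card_independent dim_span by (metis Q_def)
  then obtain X Y where XY: "E = {X, Y}" "X \<noteq> Y" by (auto simp: card_2_iff)
  have on: "X \<bullet> X = 1" "Y \<bullet> Y = 1" "X \<bullet> Y = 0" "Y \<bullet> X = 0"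
    using E XY by (auto simp: Q_def pairwise_def orthogonal_def norm_eq_1)
  have XYT: "X \<in> T x" "Y \<in> T x" using E XY by (auto simp: Q_def intro: span_base)
  note sym = normal_derivative_symmetric[OF XYT]
  define L M N where "L = W x X \<bullet> X" and "M = W x X \<bullet> Y" and "N = W x Y \<bullet> Y"
  have sum: "\<kappa>\<^sub>1 x + \<kappa>\<^sub>2 x = L + N" and prod: "\<kappa>\<^sub>1 x * \<kappa>\<^sub>2 x = L * N - M\<^sup>2"
    using curvatures_in_basis(3,4)[of x X Y 1 "L + N" "L * N - M\<^sup>2"] E on
    by (simp_all add: XY Q_def L_def M_def N_def)
  have "tracefree_norm_sq P f \<nu> x = (\<Sum>e\<in>E. \<Sum>e'\<in>E. (tracefree_second_ff P f \<nu> x e e')\<^sup>2)"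
    unfolding tracefree_norm_sq_def bilinear_norm_sq_def Let_def E_def Q_def ..
  also have "\<dots> = (L - E1 P f \<nu> x)\<^sup>2 + 2 * M\<^sup>2 + (N - E1 P f \<nu> x)\<^sup>2"
    using XY(2) on sym by (simp add: XY(1) tracefree_second_ff_def second_ff_def L_def M_def N_def)
  also have "\<dots> = ((L + N)\<^sup>2 - 4 * (L * N - M\<^sup>2)) / 2"
    by (simp add: E1_def sum power2_eq_square field_simps)
  also have "\<dots> = (\<kappa>\<^sub>1 x - \<kappa>\<^sub>2 x)\<^sup>2 / 2"
    unfolding sum[symmetric] prod[symmetric] by (simp add: power2_eq_square algebra_simps)
  finally show ?thesis .
qed

text \<open>Sum and product are continuous in every chart, and the gap between the curvatures is the
  square root of (sum)^2 - 4 (product). This remains continuous at umbilic points.\<close>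

lemma continuous_curvatures: "continuous_on UNIV \<kappa>\<^sub>1" "continuous_on UNIV \<kappa>\<^sub>2"
proof -
  have loc: "continuous_on UNIV g" if "\<And>U \<phi>. (U, \<phi>) \<in> P \<Longrightarrow> continuous_on U (g \<circ> \<phi>)"
    for g :: "'m \<Rightarrow> real"
  proof -
    have "isCont g x" for x
    proof -
      obtain U \<phi> u where u: "(U, \<phi>) \<in> P" "u \<in> U" and x: "\<phi> u = x" by (rule chart_at)
      note c = chart_facts[OF closed u(1)]
      have inv: "inv_into U \<phi> ` \<phi> ` U \<subseteq> U" by (auto intro: inv_into_into)
      have "continuous_on (\<phi> ` U) ((g \<circ> \<phi>) \<circ> inv_into U \<phi>)"
        by (intro continuous_on_compose c continuous_on_subset[OF that[OF u(1)] inv])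
      then have "continuous_on (\<phi> ` U) g"
        by (rule continuous_on_cong[THEN iffD1, rotated -1]) (auto simp: f_inv_into_f)
      then show ?thesis using c(2) u x by (auto simp: continuous_on_eq_continuous_at)
    qed
    then show ?thesis by (simp add: continuous_at_imp_continuous_on)
  qed
  have S: "continuous_on UNIV (\<lambda>x. \<kappa>\<^sub>1 x + \<kappa>\<^sub>2 x)"
  proof (rule loc)
    fix U \<phi> assume c: "(U, \<phi>) \<in> P"
    have "continuous_on U (\<lambda>u. chart_sum \<phi> u / (area_density f \<phi> u)\<^sup>2)"
      unfolding chart_sum_def Let_def using area_density_pos[OF c]
      by (intro continuous_intros smooth_on_continuous_derivative smooth_charts[OF c]
          area_density_continuous) force
    then show "continuous_on U ((\<lambda>x. \<kappa>\<^sub>1 x + \<kappa>\<^sub>2 x) \<circ> \<phi>)"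
      by (rule continuous_on_cong[THEN iffD1, rotated -1]) (simp_all add: curvatures_in_chart(3)[OF c])
  qed
  have K: "continuous_on UNIV (\<lambda>x. \<kappa>\<^sub>1 x * \<kappa>\<^sub>2 x)"
  proof (rule loc)
    fix U \<phi> assume c: "(U, \<phi>) \<in> P"
    have "continuous_on U (\<lambda>u. chart_prod \<phi> u / (area_density f \<phi> u)\<^sup>2)"
      unfolding chart_prod_def Let_def using area_density_pos[OF c]
      by (intro continuous_intros smooth_on_continuous_derivative smooth_charts[OF c]
          area_density_continuous) force
    then show "continuous_on U ((\<lambda>x. \<kappa>\<^sub>1 x * \<kappa>\<^sub>2 x) \<circ> \<phi>)"
      by (rule continuous_on_cong[THEN iffD1, rotated -1]) (simp_all add: curvatures_in_chart(4)[OF c])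
  qed
  have "\<kappa>\<^sub>1 x - \<kappa>\<^sub>2 x = sqrt ((\<kappa>\<^sub>1 x + \<kappa>\<^sub>2 x)\<^sup>2 - 4 * (\<kappa>\<^sub>1 x * \<kappa>\<^sub>2 x))" for x
  proof -
    have "(\<kappa>\<^sub>1 x + \<kappa>\<^sub>2 x)\<^sup>2 - 4 * (\<kappa>\<^sub>1 x * \<kappa>\<^sub>2 x) = (\<kappa>\<^sub>1 x - \<kappa>\<^sub>2 x)\<^sup>2"
      by (simp add: power2_eq_square algebra_simps)
    then show ?thesis using lambda2_le[of x] by simp
  qed
  then have D: "continuous_on UNIV (\<lambda>x. \<kappa>\<^sub>1 x - \<kappa>\<^sub>2 x)"
    by (simp only:) (intro continuous_intros S K)
  have "continuous_on UNIV (\<lambda>x. ((\<kappa>\<^sub>1 x + \<kappa>\<^sub>2 x) + (\<kappa>\<^sub>1 x - \<kappa>\<^sub>2 x)) / 2)"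
    "continuous_on UNIV (\<lambda>x. ((\<kappa>\<^sub>1 x + \<kappa>\<^sub>2 x) - (\<kappa>\<^sub>1 x - \<kappa>\<^sub>2 x)) / 2)"
    by (intro continuous_intros S D; simp)+
  then show "continuous_on UNIV \<kappa>\<^sub>1" "continuous_on UNIV \<kappa>\<^sub>2" by simp_all
qed

section \<open>Nearest boundary points and the normal map\<close>

lemma compact_range: "compact (range f)"
proof -
  have "continuous_on UNIV f" using embedding by (simp add: smooth_embedding_def homeomorphism_def)
  then show ?thesis using closed
    by (intro compact_continuous_image) (auto simp: closed_surface_def)
qed

text \<open>The squared distance to p, restricted to the image of a coordinate line through u, has a
  minimum at parameter 0; these are its first- and second-order conditions, divided by 2.\<close>

lemma foot_point:
  assumes min: "\<And>y. dist p (f x) \<le> dist p (f y)"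
    and chart: "(U, \<phi>) \<in> P" "u \<in> U" "\<phi> u = x"
  shows "(f x - p) \<bullet> dF \<phi> u a = 0"
    and "0 \<le> dF \<phi> u a \<bullet> dF \<phi> u a + (f x - p) \<bullet> frechet_derivative (\<lambda>y. dF \<phi> y a) (at u) a"
proof -
  have oU: "open U" using chart_facts(1)[OF closed chart(1)] .
  have "\<exists>\<delta>>0. \<forall>s. \<bar>s\<bar> < \<delta> \<longrightarrow> u + s *\<^sub>R a \<in> U"
  proof -
    have "open ((\<lambda>s. u + s *\<^sub>R a) -` U)"
      using oU by (intro open_vimage) (auto intro!: continuous_intros)
    moreover have "0 \<in> (\<lambda>s. u + s *\<^sub>R a) -` U" using chart(2) by simp
    ultimately obtain e where e: "0 < e" "ball 0 e \<subseteq> (\<lambda>s. u + s *\<^sub>R a) -` U"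
      by (meson open_contains_ball)
    have "u + s *\<^sub>R a \<in> U" if "\<bar>s\<bar> < e" for s
      using subsetD[OF e(2), of s] that by simp
    then show ?thesis using e(1) by blast
  qed
  then obtain \<delta> where \<delta>: "0 < \<delta>" "\<And>s. \<bar>s\<bar> < \<delta> \<Longrightarrow> u + s *\<^sub>R a \<in> U" by blast
  let ?F = "f \<circ> \<phi>" and ?H = "frechet_derivative (\<lambda>y. dF \<phi> y a) (at u)"
  define G where "G y = (?F y - p) \<bullet> (?F y - p)" for y
  define M where "M y = 2 * ((?F y - p) \<bullet> dF \<phi> y a)" for y
  have D: "((\<lambda>y. ?F y - p) has_derivative dF \<phi> y) (at y)" if "y \<in> U" for y
  proof -
    have "((\<lambda>y. ?F y - p) has_derivative (\<lambda>h. dF \<phi> y h - 0)) (at y)"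
      by (rule has_derivative_diff[OF chart_derivatives(1)[OF chart(1) that] has_derivative_const])
    then show ?thesis unfolding diff_0_right .
  qed
  have G: "(G has_derivative (\<lambda>h. 2 * ((?F y - p) \<bullet> dF \<phi> y h))) (at y)" if "y \<in> U" for y
    using has_derivative_inner[OF D[OF that] D[OF that]]
    unfolding G_def by (simp only: inner_commute[of "dF \<phi> y _"] mult_2)
  have M: "(M has_derivative
      (\<lambda>h. 2 * ((?F u - p) \<bullet> ?H h + dF \<phi> u h \<bullet> dF \<phi> u a))) (at u)"
    unfolding M_def
    by (rule has_derivative_mult_right[OF has_derivative_inner[OF D[OF chart(2)]
            second_derivative[OF chart(1,2)]]])
  have 1: "((\<lambda>s. G (u + s *\<^sub>R a)) has_real_derivative M (u + s *\<^sub>R a)) (at s)" if "\<bar>s\<bar> < \<delta>" for s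
    unfolding M_def by (rule has_real_derivative_along_line[OF G[OF \<delta>(2)[OF that]]])
  have 2: "((\<lambda>s. M (u + s *\<^sub>R a)) has_real_derivative
      2 * ((?F u - p) \<bullet> ?H a + dF \<phi> u a \<bullet> dF \<phi> u a)) (at 0)"
  proof -
    have "(M has_derivative (\<lambda>h. 2 * ((?F u - p) \<bullet> ?H h + dF \<phi> u h \<bullet> dF \<phi> u a))) (at (u + 0 *\<^sub>R a))"
      using M by (simp only: scaleR_zero_left add_0_right)
    then show ?thesis by (rule has_real_derivative_along_line)
  qed
  have 3: "G (u + 0 *\<^sub>R a) \<le> G (u + s *\<^sub>R a)" for s
  proof -
    have "(norm (f x - p))\<^sup>2 \<le> (norm (f (\<phi> (u + s *\<^sub>R a)) - p))\<^sup>2"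
      using power_mono[OF min[of "\<phi> (u + s *\<^sub>R a)"] zero_le_dist, of 2]
      by (simp only: dist_norm norm_minus_commute[of p])
    then show ?thesis
      by (simp only: G_def chart(3) power2_norm_eq_inner o_apply scaleR_zero_left add_0_right)
  qed
  have lm: "M (u + 0 *\<^sub>R a) = 0" "0 \<le> 2 * ((?F u - p) \<bullet> ?H a + dF \<phi> u a \<bullet> dF \<phi> u a)"
    using local_min_derivatives[where g = "\<lambda>s. G (u + s *\<^sub>R a)" and m = "\<lambda>s. M (u + s *\<^sub>R a)",
        OF \<delta>(1) _ 2 3] 1 by blast+
  have "M u = 0" using lm(1) by (simp only: scaleR_zero_left add_0_right)
  then have "(?F u - p) \<bullet> dF \<phi> u a = 0" unfolding M_def by linarith
  then show "(f x - p) \<bullet> dF \<phi> u a = 0" by (simp only: o_apply chart(3))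
  have "0 \<le> dF \<phi> u a \<bullet> dF \<phi> u a + (?F u - p) \<bullet> ?H a"
  proof -
    have "0 \<le> 2 * (r + s) \<Longrightarrow> 0 \<le> s + r" for r s :: real by simp
    then show ?thesis using lm(2) .
  qed
  then show "0 \<le> dF \<phi> u a \<bullet> dF \<phi> u a + (f x - p) \<bullet> ?H a" by (simp only: o_apply chart(3))
qed

text \<open>The ball around \<open>p\<close> through the nearest boundary point \<open>f x\<close> touches the surface from inside,
  so no principal curvature at \<open>x\<close> exceeds the reciprocal of its radius \<open>d\<close>.\<close>

lemma nearest_point:
  assumes p: "p \<in> \<Omega>"
  obtains x d where "0 \<le> d" "d * \<kappa>\<^sub>1 x \<le> 1" "p = f x - d *\<^sub>R \<nu> x"
proof -
  have \<Omega>: "open \<Omega>" "frontier \<Omega> = range f" using encloses by (auto simp: encloses_def)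
  have "\<exists>y\<in>range f. \<forall>z\<in>range f. dist p y \<le> dist p z"
    by (rule continuous_attains_inf) (auto intro!: compact_range continuous_intros)
  then obtain x where min: "\<And>y. dist p (f x) \<le> dist p (f y)" by auto
  define d where "d = dist p (f x)"
  have "f x \<notin> \<Omega>" using \<Omega> frontier_disjoint_eq[of \<Omega>] by blast
  then have d: "0 < d" using p by (auto simp: d_def)
  \<comment> \<open>A ball around p that leaves the domain is a connected set meeting the frontier,
    so it would contain a surface point closer than the nearest one.\<close>
  have ball: "ball p d \<subseteq> \<Omega>"
  proof (rule ccontr)
    assume "\<not> ball p d \<subseteq> \<Omega>"
    then have "ball p d \<inter> frontier \<Omega> \<noteq> {}"
      using p d by (intro connected_Int_frontier) (auto intro: centre_in_ball[THEN iffD2])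
    then obtain y where "dist p (f y) < d" unfolding \<Omega>(2) by auto
    then show False using min[of y] by (simp add: d_def)
  qed
  obtain U \<phi> u where chart: "(U, \<phi>) \<in> P" "u \<in> U" and x: "\<phi> u = x" by (rule chart_at)
  note fp = foot_point[OF min chart x]
  \<comment> \<open>The signed distance along the normal. Its absolute value is d because the normal
    has length 1; its sign is settled by the outward orientation.\<close>
  define c where "c = (f x - p) \<bullet> \<nu> x"
  have nu: "\<nu> x \<bullet> \<nu> x = 1" using norm_normal[of x] by (simp add: norm_eq_1)
  have par: "f x - p = c *\<^sub>R \<nu> x"
    unfolding c_def
  proof (rule parallel_unit_normal[OF nu])
    show "\<nu> x \<bullet> dF \<phi> u (axis 1 1) = 0" "\<nu> x \<bullet> dF \<phi> u (axis 2 1) = 0"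
      using normal_orthogonal[OF chart] by (simp_all add: x)
    show "(dF \<phi> u (axis 1 1) \<bullet> dF \<phi> u (axis 1 1)) * (dF \<phi> u (axis 2 1) \<bullet> dF \<phi> u (axis 2 1)) -
        (dF \<phi> u (axis 1 1) \<bullet> dF \<phi> u (axis 2 1))\<^sup>2 \<noteq> 0"
      using chart_basis(2)[OF chart] by simp
  qed (rule fp)+
  have absc: "\<bar>c\<bar> = d"
    using arg_cong[OF par, of norm] norm_normal[of x] by (simp add: d_def dist_norm norm_minus_commute)
  \<comment> \<open>With the other sign, short outward normal segments from \<open>f x\<close> would
    run into the ball around p and hence into the domain.\<close>
  have "c = d"
  proof (rule ccontr)
    assume "c \<noteq> d"
    then have c: "c = - d" using absc by linarith
    have "\<forall>\<^sub>F t in at_right 0. f x + t *\<^sub>R \<nu> x \<notin> \<Omega>"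
      using normal by (auto simp: outward_unit_normal_def elim: eventually_mono)
    moreover have "\<forall>\<^sub>F t in at_right 0. t \<in> {0<..<d}" using d by (rule eventually_at_right_real)
    ultimately have ev: "\<forall>\<^sub>F t in at_right 0. f x + t *\<^sub>R \<nu> x \<notin> \<Omega> \<and> t \<in> {0<..<d}"
      by (rule eventually_conj)
    then obtain t where t: "f x + t *\<^sub>R \<nu> x \<notin> \<Omega>" "0 < t" "t < d"
      using eventually_happens[OF ev] by auto
    have "f x + t *\<^sub>R \<nu> x - p = (t - d) *\<^sub>R \<nu> x"
      using par c by (simp add: algebra_simps)
    then have "dist p (f x + t *\<^sub>R \<nu> x) = \<bar>t - d\<bar>"
      using norm_normal[of x] by (simp add: dist_norm norm_minus_commute[of p])
    then have "f x + t *\<^sub>R \<nu> x \<in> ball p d" using t by simp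
    then show False using ball t(1) by blast
  qed
  have peq: "p = f x - d *\<^sub>R \<nu> x" using par \<open>c = d\<close> by (simp add: algebra_simps)
  \<comment> \<open>The second-order condition is evaluated along an eigenvector for the largest
    curvature, where it is strongest.\<close>
  obtain Z where Z: "Z \<in> T x" "Z \<noteq> 0" "\<And>Y. Y \<in> T x \<Longrightarrow> second_ff P f \<nu> x Z Y = \<kappa>\<^sub>1 x * (Z \<bullet> Y)"
    using lambda1_principal[of x] unfolding principal_curvatures_def by blast
  obtain a where a: "Z = dF \<phi> u a" using Z(1) tangent_plane_eq[OF chart] by (auto simp: x)
  have "dN \<phi> u a \<bullet> dF \<phi> u a = \<kappa>\<^sub>1 x * (Z \<bullet> Z)"
    using Z(3)[OF Z(1)] normal_derivative_eq[OF chart] by (simp add: second_ff_def a x)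
  then have II: "\<nu> x \<bullet> frechet_derivative (\<lambda>y. dF \<phi> y a) (at u) a = - (\<kappa>\<^sub>1 x * (Z \<bullet> Z))"
    using second_ff_second_derivative[OF chart, of a a] unfolding x by linarith
  have "0 \<le> Z \<bullet> Z - d * (\<kappa>\<^sub>1 x * (Z \<bullet> Z))"
    using fp(2)[of a] unfolding par inner_scaleR_left II by (simp add: a \<open>c = d\<close>)
  also have "\<dots> = (1 - d * \<kappa>\<^sub>1 x) * (Z \<bullet> Z)" by (simp add: algebra_simps)
  finally have "d * \<kappa>\<^sub>1 x \<le> 1" using inner_gt_zero_iff[THEN iffD2, OF Z(2)]
    unfolding zero_le_mult_iff by linarith
  then show ?thesis using d peq by (intro that[of d x]) simp_all
qed

section \<open>The inward normal map in coordinates and its Jacobian\<close>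

definition tube :: "(real^2 \<Rightarrow> 'm) \<Rightarrow> real^3 \<Rightarrow> real^3" where
  "tube \<phi> z = f (\<phi> (base z)) - z $ 3 *\<^sub>R \<nu> (\<phi> (base z))"

definition dtube :: "(real^2 \<Rightarrow> 'm) \<Rightarrow> real^3 \<Rightarrow> real^3 \<Rightarrow> real^3" where
  "dtube \<phi> z h = dF \<phi> (base z) (base h) - z $ 3 *\<^sub>R dN \<phi> (base z) (base h) - h $ 3 *\<^sub>R \<nu> (\<phi> (base z))"

lemma tube_has_derivative:
  assumes c: "(U, \<phi>) \<in> P" "base z \<in> U"
  shows "(tube \<phi> has_derivative dtube \<phi> z) (at z)"
proof -
  have b: "(base has_derivative base) (at z)"
    using linear_base by (simp add: linear_imp_has_derivative)
  have 3: "((\<lambda>z::real^3. z $ 3) has_derivative (\<lambda>h. h $ 3)) (at z)"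
    by (intro bounded_linear_imp_has_derivative bounded_linear_vec_nth)
  have F: "((\<lambda>z. f (\<phi> (base z))) has_derivative (\<lambda>h. dF \<phi> (base z) (base h))) (at z)"
    using diff_chain_at[OF b chart_derivatives(1)[OF c]] by (simp add: o_def)
  have N: "((\<lambda>z. \<nu> (\<phi> (base z))) has_derivative (\<lambda>h. dN \<phi> (base z) (base h))) (at z)"
    using diff_chain_at[OF b chart_derivatives(2)[OF c]] by (simp add: o_def)
  show ?thesis
    unfolding tube_def dtube_def
    by (rule has_derivative_eq_rhs[OF has_derivative_diff[OF F has_derivative_scaleR[OF 3 N]]])
      (simp add: fun_eq_iff algebra_simps)
qed

text \<open>Multiplying by the determinant of the frame at \<open>t = 0\<close> turns the Jacobian into the mixed Gram
  determinant \<open>det (I - t II)\<close>, so that the shape operator need not be written out in the basis.\<close>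

lemma abs_det_dtube:
  fixes \<phi> z
  assumes c: "(U, \<phi>) \<in> P" "base z \<in> U"
  defines "x \<equiv> \<phi> (base z)"
  shows "\<bar>det (matrix (dtube \<phi> z))\<bar> =
    area_density f \<phi> (base z) * \<bar>(1 - \<kappa>\<^sub>1 x * z $ 3) * (1 - \<kappa>\<^sub>2 x * z $ 3)\<bar>"
proof -
  define u t where "u = base z" and "t = z $ 3"
  define X Y X' Y' where "X = dF \<phi> u (axis 1 1)" and "Y = dF \<phi> u (axis 2 1)"
    and "X' = dN \<phi> u (axis 1 1)" and "Y' = dN \<phi> u (axis 2 1)"
  define a where "a = area_density f \<phi> u"
  note cu = c[folded u_def]
  have D: "0 < a" "a\<^sup>2 = (X \<bullet> X) * (Y \<bullet> Y) - (X \<bullet> Y)\<^sup>2"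
    using area_density_pos[OF cu] chart_basis(2,3)[OF cu] by (simp_all add: a_def X_def Y_def)
  have n: "\<nu> x \<bullet> \<nu> x = 1" "\<nu> x \<bullet> X = 0" "\<nu> x \<bullet> Y = 0"
    using norm_normal[of x] normal_orthogonal[OF cu]
    by (simp_all add: norm_eq_1 x_def u_def X_def Y_def)
  have sym: "Y' \<bullet> X = X' \<bullet> Y"
    using second_ff_symmetric[OF cu] by (simp add: X_def Y_def X'_def Y'_def)
  let ?p = "X - t *\<^sub>R X'" and ?q = "Y - t *\<^sub>R Y'"
  have ax: "base (axis 1 1) = axis 1 1" "base (axis 2 1) = axis 2 1" "base (axis 3 1) = 0"
    by (simp_all add: base_def vec_eq_iff forall_2 axis_def)
  note lin0 = linear_0[OF chart_derivatives(3)[OF cu]] linear_0[OF chart_derivatives(4)[OF cu]]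
  have cols: "dtube \<phi> z (axis 1 1) = ?p" "dtube \<phi> z (axis 2 1) = ?q" "dtube \<phi> z (axis 3 1) = - \<nu> x"
    unfolding dtube_def ax u_def[symmetric]
    by (simp_all add: axis_def X_def Y_def X'_def Y'_def t_def x_def u_def lin0[unfolded u_def])
  \<comment> \<open>The columns of the Jacobian matrix become rows and the last one changes sign,
    which leaves the absolute value of the determinant alone.\<close>
  define d where "d = det (vector [?p, ?q, \<nu> x] :: real^3^3)"
  have "\<bar>det (matrix (dtube \<phi> z))\<bar> = \<bar>d\<bar>"
    unfolding d_def det_3 by (simp add: matrix_def cols) (simp add: algebra_simps)
  moreover have "\<bar>d\<bar> * a = a * (a * \<bar>(1 - \<kappa>\<^sub>1 x * t) * (1 - \<kappa>\<^sub>2 x * t)\<bar>)"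
  proof -
    let ?d0 = "det (vector [X, Y, \<nu> x] :: real^3^3)"
    have "?d0\<^sup>2 = a\<^sup>2"
      using det_unit_normal[OF n, of X Y] unfolding D(2) by (simp add: power2_eq_square inner_commute)
    then have d0: "\<bar>?d0\<bar> = a" using D(1) by (simp add: power2_eq_iff) linarith
    have S: "a\<^sup>2 * (\<kappa>\<^sub>1 x + \<kappa>\<^sub>2 x) = (X' \<bullet> X) * (Y \<bullet> Y) - 2 * (X' \<bullet> Y) * (X \<bullet> Y) + (Y' \<bullet> Y) * (X \<bullet> X)"
      and K: "a\<^sup>2 * (\<kappa>\<^sub>1 x * \<kappa>\<^sub>2 x) = (X' \<bullet> X) * (Y' \<bullet> Y) - (X' \<bullet> Y)\<^sup>2"
      using curvatures_in_chart(3,4)[OF cu] D(1)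
      by (simp_all add: x_def u_def a_def chart_sum_def chart_prod_def Let_def X_def Y_def X'_def Y'_def)
    have "d * ?d0 = (?p \<bullet> X) * (?q \<bullet> Y) - (?p \<bullet> Y) * (?q \<bullet> X)"
      unfolding d_def by (rule det_unit_normal[OF n])
    also have "\<dots> = a\<^sup>2 - t * (a\<^sup>2 * (\<kappa>\<^sub>1 x + \<kappa>\<^sub>2 x)) + t\<^sup>2 * (a\<^sup>2 * (\<kappa>\<^sub>1 x * \<kappa>\<^sub>2 x))"
      unfolding S K unfolding D(2)
      by (simp add: inner_diff_left sym inner_commute[of Y X] power2_eq_square algebra_simps)
    also have "\<dots> = a * (a * ((1 - \<kappa>\<^sub>1 x * t) * (1 - \<kappa>\<^sub>2 x * t)))"
      by (simp add: power2_eq_square algebra_simps)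
    finally have "\<bar>d * ?d0\<bar> = \<bar>a * (a * ((1 - \<kappa>\<^sub>1 x * t) * (1 - \<kappa>\<^sub>2 x * t)))\<bar>" by (rule arg_cong)
    then show ?thesis using D(1) by (simp add: abs_mult d0)
  qed
  ultimately show ?thesis using D(1) by (simp add: u_def t_def a_def)
qed

section \<open>The volume inequality\<close>

lemma is_area_measure: "is_area_measure P f \<mu>"
  by (rule is_area_measure_area_measure[OF closed smooth_maps(1)])

lemma sets_area [measurable_cong, simp]: "sets \<mu> = sets borel"
  using is_area_measure by (simp add: is_area_measure_def)

lemma space_area [simp]:
  "space \<mu> = UNIV"
  using sets_eq_imp_space_eq[OF sets_area] by simp

lemma emeasure_area_chart:
  assumes "(U, \<phi>) \<in> P" "B \<in> sets borel" "B \<subseteq> U"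
  shows "emeasure \<mu> (\<phi> ` B) = (\<integral>\<^sup>+u\<in>B. ennreal (area_density f \<phi> u) \<partial>lborel)"
  using is_area_measure assms unfolding is_area_measure_def by fast

text \<open>\<open>is_area_measure\<close> only prescribes the measure of chart images of Borel
  sets. This suffices to identify the measure restricted to one chart image with the push-forward of
  Lebesgue measure weighted by the area density.\<close>

lemma nn_integral_area_chart:
  fixes h :: "'m \<Rightarrow> ennreal"
  assumes c: "(U, \<phi>) \<in> P" and A: "A \<in> sets borel" "A \<subseteq> \<phi> ` U" and h: "h \<in> borel_measurable borel"
  shows "(\<integral>\<^sup>+x\<in>A. h x \<partial>\<mu>) =
    (\<integral>\<^sup>+u\<in>U \<inter> \<phi> -` A. ennreal (area_density f \<phi> u) * h (\<phi> u) \<partial>lborel)"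
proof -
  note cf = chart_facts[OF closed c]
  define a where "a u = (if u \<in> U then area_density f \<phi> u else 0)" for u
  \<comment> \<open>The value off the chart domain is arbitrary, because the density a vanishes
    there.\<close>
  define w where "w u = (if u \<in> U then \<phi> u else undefined)" for u
  have a: "a \<in> borel_measurable borel"
    unfolding a_def using cf(1) area_density_continuous[OF smooth_charts(1)[OF c]]
    by (intro borel_measurable_continuous_on_if) auto
  have w: "w \<in> borel_measurable borel"
    unfolding w_def using cf by (intro borel_measurable_continuous_on_if) auto
  have \<phi>U: "\<phi> ` U \<in> sets borel" using cf(2) by simp
  let ?M = "distr (density lborel (\<lambda>u. ennreal (a u))) borel w"
  have meas: "density \<mu> (indicator (\<phi> ` U)) = ?M"
  proof (rule measure_eqI)
    fix S assume "S \<in> sets (density \<mu> (indicator (\<phi> ` U)))"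
    then have S: "S \<in> sets borel" by simp
    let ?B = "U \<inter> \<phi> -` S"
    have "emeasure (density \<mu> (indicator (\<phi> ` U))) S = (\<integral>\<^sup>+x. indicator (\<phi> ` U) x * indicator S x \<partial>\<mu>)"
      using S \<phi>U by (intro emeasure_density) auto
    also have "\<dots> = (\<integral>\<^sup>+x. indicator (\<phi> ` ?B) x \<partial>\<mu>)"
      by (intro nn_integral_cong) (auto simp: indicator_def)
    also have "\<phi> ` ?B \<in> sets borel"
      using chart_image_borel[OF closed c chart_vimage_borel[OF closed c S]] by simp
    then have "(\<integral>\<^sup>+x. indicator (\<phi> ` ?B) x \<partial>\<mu>) = emeasure \<mu> (\<phi> ` ?B)" by simp
    also have "\<dots> = (\<integral>\<^sup>+u\<in>?B. ennreal (area_density f \<phi> u) \<partial>lborel)"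
      by (intro emeasure_area_chart[OF c] chart_vimage_borel[OF closed c S]) auto
    also have "\<dots> = (\<integral>\<^sup>+u. ennreal (a u) * indicator (w -` S) u \<partial>lborel)"
      by (intro nn_integral_cong) (auto simp: indicator_def a_def w_def)
    also have "\<dots> = emeasure ?M S"
      using S a w measurable_sets[OF w S] by (simp add: emeasure_distr emeasure_density)
    finally show "emeasure (density \<mu> (indicator (\<phi> ` U))) S = emeasure ?M S" .
  qed simp
  have hA: "(\<lambda>x. h x * indicator A x) \<in> borel_measurable borel" using h A(1) by simp
  have "(\<integral>\<^sup>+x\<in>A. h x \<partial>\<mu>) = (\<integral>\<^sup>+x. indicator (\<phi> ` U) x * (h x * indicator A x) \<partial>\<mu>)"
    using A(2) by (intro nn_integral_cong) (auto simp: indicator_def)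
  also have "\<dots> = (\<integral>\<^sup>+x. h x * indicator A x \<partial>density \<mu> (indicator (\<phi> ` U)))"
    using hA \<phi>U by (subst nn_integral_density) auto
  also have "\<dots> = (\<integral>\<^sup>+u. ennreal (a u) * (h (w u) * indicator A (w u)) \<partial>lborel)"
    unfolding meas using hA w a measurable_compose[OF w hA]
    by (simp add: nn_integral_distr nn_integral_density)
  also have "\<dots> = (\<integral>\<^sup>+u\<in>U \<inter> \<phi> -` A. ennreal (area_density f \<phi> u) * h (\<phi> u) \<partial>lborel)"
    by (intro nn_integral_cong) (auto simp: indicator_def a_def w_def)
  finally show ?thesis .
qed

text \<open>The area density may be unbounded on a whole chart domain, but it is bounded on a closed
  ball inside it. Images of such open balls cover the surface, and compactness leaves finitely
  many.\<close>

lemma finite_area: "finite_measure \<mu>"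
proof
  have loc: "\<exists>V. open V \<and> x \<in> V \<and> emeasure \<mu> V < \<infinity>" for x
  proof -
    obtain U \<phi> u where c: "(U, \<phi>) \<in> P" "u \<in> U" and x: "\<phi> u = x" by (rule chart_at)
    note cf = chart_facts[OF closed c(1)]
    obtain r where r: "0 < r" "cball u r \<subseteq> U" using cf(1) c(2) by (meson open_contains_cball)
    have cont: "continuous_on (cball u r) (area_density f \<phi>)"
      using area_density_continuous[OF smooth_charts(1)[OF c(1)]] r(2) by (rule continuous_on_subset)
    then have "bounded (area_density f \<phi> ` cball u r)"
      by (intro compact_imp_bounded compact_continuous_image) auto
    then obtain K where "\<forall>y\<in>area_density f \<phi> ` cball u r. norm y \<le> K"
      unfolding bounded_iff by blast
    then have K: "area_density f \<phi> v \<le> K" if "v \<in> cball u r" for v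
      using that by force
    have bU: "ball u r \<subseteq> U" using r(2) ball_subset_cball by blast
    have "emeasure \<mu> (\<phi> ` ball u r) = (\<integral>\<^sup>+v\<in>ball u r. ennreal (area_density f \<phi> v) \<partial>lborel)"
      using bU by (intro emeasure_area_chart[OF c(1)]) auto
    also have "\<dots> \<le> (\<integral>\<^sup>+v. ennreal K * indicator (ball u r) v \<partial>lborel)"
      using K by (intro nn_integral_mono) (auto simp: indicator_def intro!: ennreal_leI)
    also have "\<dots> = ennreal K * emeasure lborel (ball u r)"
      by (intro nn_integral_cmult_indicator) auto
    also have "\<dots> < \<infinity>"
      using emeasure_bounded_finite[of "ball u r"] by (simp add: ennreal_mult_less_top)
    finally have fin: "emeasure \<mu> (\<phi> ` ball u r) < \<infinity>" .
    have "\<phi> ` ball u r = \<phi> ` U \<inter> inv_into U \<phi> -` ball u r"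
      using bU cf(4) by (auto simp: inv_into_f_f f_inv_into_f subset_iff intro!: image_eqI)
    moreover have "open (\<phi> ` U \<inter> inv_into U \<phi> -` ball u r)"
      by (rule continuous_open_preimage[OF cf(5,2)]) simp
    ultimately have "open (\<phi> ` ball u r)" by simp
    then show ?thesis using fin x r(1) by (intro exI[of _ "\<phi> ` ball u r"]) auto
  qed
  then obtain V where V: "\<And>x. open (V x)" "\<And>x. x \<in> V x" "\<And>x. emeasure \<mu> (V x) < \<infinity>" by metis
  have "compact (UNIV :: 'm set)" using closed by (simp add: closed_surface_def)
  then obtain C where C: "finite C" "UNIV \<subseteq> (\<Union>x\<in>C. V x)"
    using compactE_image[of UNIV UNIV V] V by (metis UNIV_I UN_I subsetI)
  have "emeasure \<mu> UNIV \<le> emeasure \<mu> (\<Union>x\<in>C. V x)"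
    using C V(1) by (intro emeasure_mono) (auto intro!: sets.finite_UN)
  also have "\<dots> \<le> (\<Sum>x\<in>C. emeasure \<mu> (V x))"
    using C V(1) by (intro emeasure_subadditive_finite) auto
  also have "\<dots> < \<infinity>" using V(3) C(1) by (simp add: less_top[symmetric])
  finally show "emeasure \<mu> (space \<mu>) \<noteq> \<infinity>" by simp
qed

lemma integrable_area:
  fixes h :: "'m \<Rightarrow> real"
  assumes "continuous_on UNIV h"
  shows "integrable \<mu> h"
proof -
  interpret finite_measure \<mu> by (rule finite_area)
  have "bounded (range h)" using assms closed
    by (intro compact_imp_bounded compact_continuous_image) (simp_all add: closed_surface_def)
  then obtain B where "\<And>x. norm (h x) \<le> B" unfolding bounded_iff by auto
  then show ?thesis
    using assms by (intro integrable_const_bound[of _ B]) (auto intro!: borel_measurable_continuous_onI simp: measurable_cong_sets[OF sets_area refl])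
qed

text \<open>The Jacobian \<open>(1 - \<kappa>\<^sub>1 t) (1 - \<kappa>\<^sub>2 t)\<close> of the inward normal map, integrated over \<open>0 \<le> t \<le> 1 / \<kappa>\<^sub>1\<close>.\<close>

definition focal_volume :: "'m \<Rightarrow> real" where
  "focal_volume x = (3 * \<kappa>\<^sub>1 x - \<kappa>\<^sub>2 x) / (6 * (\<kappa>\<^sub>1 x)\<^sup>2)"

lemma focal_volume_nonneg: "0 \<le> focal_volume x"
  using lambda1_pos[of x] lambda2_le[of x] unfolding focal_volume_def
  by (intro divide_nonneg_nonneg) auto

lemma continuous_focal_volume: "continuous_on UNIV focal_volume"
proof -
  have "\<kappa>\<^sub>1 x \<noteq> 0" for x using lambda1_pos[of x] by simp
  then show ?thesis unfolding focal_volume_def[abs_def]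
    by (intro continuous_intros continuous_curvatures) simp
qed

lemma borel_focal_volume: "(\<lambda>x. ennreal (focal_volume x)) \<in> borel_measurable borel"
  using borel_measurable_continuous_onI[OF continuous_focal_volume] by simp

text \<open>The measure of a differentiable image is at most the integral of the absolute Jacobian.
  In coordinates this integral splits into depth fibres of length
  \<open>1 / \<kappa>\<^sub>1\<close>, each contributing area density times
  \<open>focal_volume\<close>.\<close>

lemma tube_piece:
  fixes U \<phi> A
  assumes c: "(U, \<phi>) \<in> P" and A: "A \<in> sets borel" "A \<subseteq> \<phi> ` U"
  defines "S \<equiv> {z. base z \<in> U \<and> \<phi> (base z) \<in> A \<and> 0 \<le> z $ 3 \<and> z $ 3 * \<kappa>\<^sub>1 (\<phi> (base z)) \<le> 1}"
  shows "tube \<phi> ` S \<in> sets lebesgue"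
    and "emeasure lebesgue (tube \<phi> ` S) \<le> (\<integral>\<^sup>+x\<in>A. ennreal (focal_volume x) \<partial>\<mu>)"
proof -
  note cf = chart_facts[OF closed c]
  define B where "B = U \<inter> \<phi> -` A"
  have B: "B \<in> sets borel" "B \<subseteq> U" unfolding B_def using chart_vimage_borel[OF closed c A(1)] by auto
  \<comment> \<open>Extending by 0 off the chart domain makes the depth bound a Borel condition on
    all of \<open>real^3\<close>.\<close>
  define k where "k u = (if u \<in> U then \<kappa>\<^sub>1 (\<phi> u) else 0)" for u
  have \<kappa>\<phi>: "continuous_on U (\<lambda>u. \<kappa>\<^sub>1 (\<phi> u))" "continuous_on U (\<lambda>u. \<kappa>\<^sub>2 (\<phi> u))"
    using continuous_curvatures cf(3) by (auto intro: continuous_on_compose2[where t = UNIV])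
  have k: "k \<in> borel_measurable borel"
    unfolding k_def using cf(1) \<kappa>\<phi>(1) by (intro borel_measurable_continuous_on_if) auto
  have base_cont: "continuous_on X base" for X
    using linear_base by (simp add: linear_continuous_on linear_linear)
  have base_m: "base \<in> borel_measurable borel"
    by (intro borel_measurable_continuous_onI base_cont)
  have nth_m: "(\<lambda>z::real^3. z $ 3) \<in> borel_measurable borel"
    by (intro borel_measurable_continuous_onI continuous_intros)
  have S: "S \<in> sets borel"
  proof -
    have "S = base -` B \<inter> {z. 0 \<le> z $ 3} \<inter> {z. z $ 3 * k (base z) \<le> 1}"
      unfolding S_def B_def k_def by auto
    moreover have "base -` B \<in> sets borel" using measurable_sets[OF base_m B(1)] by simp
    moreover have "{z::real^3. 0 \<le> z $ 3} \<in> sets borel"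
      using borel_measurable_le[OF _ nth_m, of "\<lambda>_. 0"] by simp
    moreover have "{z::real^3. z $ 3 * k (base z) \<le> 1} \<in> sets borel"
      using borel_measurable_le[OF borel_measurable_times[OF nth_m measurable_compose[OF base_m k]],
          of "\<lambda>_. 1"] by simp
    ultimately show ?thesis by simp
  qed
  have SU: "base z \<in> U" if "z \<in> S" for z using that by (simp add: S_def)
  define F where "F z = \<bar>det (matrix (dtube \<phi> z))\<bar>" for z
  have F: "F z = area_density f \<phi> (base z) *
      \<bar>(1 - \<kappa>\<^sub>1 (\<phi> (base z)) * z $ 3) * (1 - \<kappa>\<^sub>2 (\<phi> (base z)) * z $ 3)\<bar>" if "base z \<in> U" for z
    unfolding F_def by (rule abs_det_dtube[OF c that])
  have F_cont: "continuous_on S F"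
  proof -
    have sub: "continuous_on S (\<lambda>z. g (base z))" if "continuous_on U g" for g :: "real^2 \<Rightarrow> real"
      by (rule continuous_on_compose2[OF that base_cont]) (use SU in auto)
    have "continuous_on S (\<lambda>z. area_density f \<phi> (base z) *
        \<bar>(1 - \<kappa>\<^sub>1 (\<phi> (base z)) * z $ 3) * (1 - \<kappa>\<^sub>2 (\<phi> (base z)) * z $ 3)\<bar>)"
      by (intro continuous_intros sub \<kappa>\<phi> area_density_continuous smooth_charts(1)[OF c])
    then show ?thesis
      by (rule continuous_on_cong[THEN iffD1, rotated -1]) (simp_all add: F SU)
  qed
  have "(\<integral>\<^sup>+z\<in>S. ennreal (F z) \<partial>lborel) =
      (\<integral>\<^sup>+(u::real^2). \<integral>\<^sup>+t. ennreal (F (vector [u $ 1, u $ 2, t])) * indicator S (vector [u $ 1, u $ 2, t]) \<partial>lborel \<partial>lborel)"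
  proof (rule nn_integral_real3)
    have "(\<lambda>z. if z \<in> S then F z else 0) \<in> borel_measurable borel"
      by (intro borel_measurable_continuous_on_if S F_cont continuous_on_const)
    then have "(\<lambda>z. ennreal (if z \<in> S then F z else 0)) \<in> borel_measurable borel" by simp
    also have "(\<lambda>z. ennreal (if z \<in> S then F z else 0)) = (\<lambda>z. ennreal (F z) * indicator S z)"
      by (auto simp: indicator_def)
    finally show "(\<lambda>z. ennreal (F z) * indicator S z) \<in> borel_measurable borel" .
  qed
  also have "\<dots> = (\<integral>\<^sup>+u\<in>B. ennreal (area_density f \<phi> u) * ennreal (focal_volume (\<phi> u)) \<partial>lborel)"
  proof (rule nn_integral_cong)
    fix u :: "real^2"
    have bv: "base (vector [u $ 1, u $ 2, t]) = u" for t
      by (simp add: base_def vec_eq_iff forall_2)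
    show "(\<integral>\<^sup>+t. ennreal (F (vector [u $ 1, u $ 2, t])) * indicator S (vector [u $ 1, u $ 2, t]) \<partial>lborel) =
        ennreal (area_density f \<phi> u) * ennreal (focal_volume (\<phi> u)) * indicator B u"
    proof (cases "u \<in> B")
      case True
      then have u: "u \<in> U" using B(2) by blast
      let ?x = "\<phi> u"
      have inS: "vector [u $ 1, u $ 2, t] \<in> S \<longleftrightarrow> t \<in> {0..1 / \<kappa>\<^sub>1 ?x}" for t
        using True u lambda1_pos[of ?x] unfolding S_def B_def by (auto simp: bv field_simps)
      have "(\<integral>\<^sup>+t. ennreal (F (vector [u $ 1, u $ 2, t])) * indicator S (vector [u $ 1, u $ 2, t]) \<partial>lborel) =
          (\<integral>\<^sup>+t. ennreal (area_density f \<phi> u) *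
            (ennreal \<bar>(1 - \<kappa>\<^sub>1 ?x * t) * (1 - \<kappa>\<^sub>2 ?x * t)\<bar> * indicator {0..1 / \<kappa>\<^sub>1 ?x} t) \<partial>lborel)"
        by (intro nn_integral_cong)
          (auto simp: indicator_def inS F bv u ennreal_mult area_density_nonneg)
      also have "\<dots> = ennreal (area_density f \<phi> u) * ennreal (focal_volume ?x)"
        unfolding focal_volume_def
        by (subst nn_integral_cmult) (simp_all add: nn_integral_tube_fibre lambda1_pos lambda2_le)
      finally show ?thesis using True by simp
    next
      case False
      then have "vector [u $ 1, u $ 2, t] \<notin> S" for t by (auto simp: S_def B_def bv)
      then show ?thesis using False by simp
    qed
  qed
  also have "\<dots> = (\<integral>\<^sup>+x\<in>A. ennreal (focal_volume x) \<partial>\<mu>)"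
    unfolding B_def by (rule nn_integral_area_chart[OF c A borel_focal_volume, symmetric])
  finally have int: "(\<integral>\<^sup>+z\<in>S. ennreal (F z) \<partial>lborel) = (\<integral>\<^sup>+x\<in>A. ennreal (focal_volume x) \<partial>\<mu>)" .
  have "(\<integral>\<^sup>+x\<in>A. ennreal (focal_volume x) \<partial>\<mu>) \<le> (\<integral>\<^sup>+x. ennreal (focal_volume x) \<partial>\<mu>)"
    by (intro nn_integral_mono) (auto simp: indicator_def)
  also have "\<dots> < \<infinity>"
    using nn_integral_eq_integral[OF integrable_area[OF continuous_focal_volume]] focal_volume_nonneg
    by simp
  finally have "(\<integral>\<^sup>+z\<in>S. ennreal (F z) \<partial>lborel) < \<infinity>" unfolding int .
  \<comment> \<open>Finiteness turns the nonnegative integral into absolute integrability, which the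
    bound for differentiable images presupposes.\<close>
  then obtain r where r: "0 \<le> r" "(\<integral>\<^sup>+z\<in>S. ennreal (F z) \<partial>lborel) = ennreal r"
    by (cases "\<integral>\<^sup>+z\<in>S. ennreal (F z) \<partial>lborel" rule: ennreal_cases) auto
  then have Fint: "F absolutely_integrable_on S" "integral S F = r"
    using nn_integral_iff[OF S F_cont, of r] by (auto simp: F_def)
  have der: "(tube \<phi> has_derivative dtube \<phi> z) (at z within S)" if "z \<in> S" for z
    by (rule has_derivative_at_withinI[OF tube_has_derivative[OF c SU[OF that]]])
  have SL: "S \<in> sets lebesgue" using S by simp
  have Fi: "(\<lambda>z. \<bar>det (matrix (dtube \<phi> z))\<bar>) integrable_on S"
    using Fint(1) unfolding F_def absolutely_integrable_on_def by blast
  have lm: "tube \<phi> ` S \<in> lmeasurable" by (rule measurable_differentiable_image[OF SL der Fi])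
  have "measure lebesgue (tube \<phi> ` S) \<le> r"
    using measure_differentiable_image[OF SL der Fi] Fint(2) unfolding F_def by simp
  then have "emeasure lebesgue (tube \<phi> ` S) \<le> ennreal r"
    using lm by (simp add: emeasure_eq_measure2 ennreal_leI)
  then show "emeasure lebesgue (tube \<phi> ` S) \<le> (\<integral>\<^sup>+x\<in>A. ennreal (focal_volume x) \<partial>\<mu>)"
    using r(2) int by simp
  show "tube \<phi> ` S \<in> sets lebesgue" using lm by (rule fmeasurableD)
qed

text \<open>By \<open>nearest_point\<close> the tube pieces over a Borel partition of the surface
  cover the domain. Their images may overlap, so subadditivity is used in space and additivity, from
  disjointness of the partition, on the surface.\<close>

lemma volume_le: "measure lebesgue \<Omega> \<le> (\<integral>x. focal_volume x \<partial>\<mu>)"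
proof -
  obtain U \<phi> A where c: "\<And>n::nat. (U n, \<phi> n) \<in> P" and A: "\<And>n. A n \<subseteq> \<phi> n ` U n"
    "\<And>n. A n \<in> sets borel" "disjoint_family A" "(\<Union>n. A n) = UNIV"
    by (rule borel_partition[OF closed]) (rule that)
  define S where "S n = {z. base z \<in> U n \<and> \<phi> n (base z) \<in> A n \<and> 0 \<le> z $ 3 \<and>
      z $ 3 * \<kappa>\<^sub>1 (\<phi> n (base z)) \<le> 1}" for n
  have S: "tube (\<phi> n) ` S n \<in> sets lebesgue"
    "emeasure lebesgue (tube (\<phi> n) ` S n) \<le> (\<integral>\<^sup>+x\<in>A n. ennreal (focal_volume x) \<partial>\<mu>)" for n
    unfolding S_def by (rule tube_piece[OF c A(2,1)])+
  have cover: "\<Omega> \<subseteq> (\<Union>n. tube (\<phi> n) ` S n)"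
  proof
    fix p assume "p \<in> \<Omega>"
    then obtain x d where d: "0 \<le> d" "d * \<kappa>\<^sub>1 x \<le> 1" "p = f x - d *\<^sub>R \<nu> x" by (rule nearest_point)
    obtain n where n: "x \<in> A n" using A(4) by blast
    then obtain u where u: "u \<in> U n" "x = \<phi> n u" using A(1)[of n] by blast
    define z :: "real^3" where "z = vector [u $ 1, u $ 2, d]"
    have z: "base z = u" "z $ 3 = d" by (simp_all add: z_def base_def vec_eq_iff forall_2)
    have "z \<in> S n" using n u d by (simp add: S_def z)
    moreover have "tube (\<phi> n) z = p" by (simp add: tube_def z d(3) u(2))
    ultimately show "p \<in> (\<Union>n. tube (\<phi> n) ` S n)" by blast
  qed
  let ?D = "density \<mu> (\<lambda>x. ennreal (focal_volume x))"
  have fm: "(\<lambda>x. ennreal (focal_volume x)) \<in> borel_measurable \<mu>"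
    using borel_focal_volume by (simp cong: measurable_cong_sets)
  have "emeasure lebesgue \<Omega> \<le> emeasure lebesgue (\<Union>n. tube (\<phi> n) ` S n)"
    using cover S(1) by (intro emeasure_mono) auto
  also have "\<dots> \<le> (\<Sum>n. emeasure lebesgue (tube (\<phi> n) ` S n))"
    using S(1) by (intro emeasure_subadditive_countably) auto
  also have "\<dots> \<le> (\<Sum>n. emeasure ?D (A n))"
    using S(2) A(2) by (intro suminf_le) (simp_all add: emeasure_density[OF fm])
  also have "\<dots> = emeasure ?D (\<Union>n. A n)"
    using A(2,3) by (intro suminf_emeasure) auto
  also have "\<dots> = (\<integral>\<^sup>+x. ennreal (focal_volume x) \<partial>\<mu>)"
    unfolding A(4) by (subst emeasure_density[OF fm]) simp_all
  also have "\<dots> = ennreal (\<integral>x. focal_volume x \<partial>\<mu>)"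
    by (intro nn_integral_eq_integral integrable_area continuous_focal_volume AE_I2 focal_volume_nonneg)
  finally have le: "emeasure lebesgue \<Omega> \<le> ennreal (\<integral>x. focal_volume x \<partial>\<mu>)" .
  have "\<Omega> \<in> lmeasurable" using encloses by (intro bounded_set_imp_lmeasurable) (auto simp: encloses_def)
  then show ?thesis
    using le focal_volume_nonneg by (simp add: emeasure_eq_measure2 ennreal_le_iff integral_nonneg_AE)
qed

section \<open>Pointwise identities for the integrands\<close>

lemma continuous_E1: "continuous_on UNIV (E1 P f \<nu>)"
  unfolding E1_def[abs_def] by (intro continuous_intros continuous_curvatures) simp

lemma integrable_terms:
  "integrable \<mu> (\<lambda>x. 1 / E1 P f \<nu> x)"
  "integrable \<mu> focal_volume"
  "integrable \<mu> (\<lambda>x. tracefree_norm_sq P f \<nu> x / ((\<kappa>\<^sub>1 x)\<^sup>2 * E1 P f \<nu> x))"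
  "integrable \<mu> (\<lambda>x. tracefree_norm_sq P f \<nu> x / (E1 P f \<nu> x) ^ 3)"
proof -
  have nz: "E1 P f \<nu> x \<noteq> 0" "\<kappa>\<^sub>1 x \<noteq> 0" for x
    using E1_pos[of x] lambda1_pos[of x] by simp_all
  note c = continuous_E1 continuous_curvatures
  have t: "continuous_on UNIV (tracefree_norm_sq P f \<nu>)"
    unfolding tracefree_norm_sq_eq[abs_def] by (intro continuous_intros c) simp
  show "integrable \<mu> (\<lambda>x. 1 / E1 P f \<nu> x)"
    "integrable \<mu> (\<lambda>x. tracefree_norm_sq P f \<nu> x / ((\<kappa>\<^sub>1 x)\<^sup>2 * E1 P f \<nu> x))"
    "integrable \<mu> (\<lambda>x. tracefree_norm_sq P f \<nu> x / (E1 P f \<nu> x) ^ 3)"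
    by (intro integrable_area continuous_intros c t; simp add: nz)+
  show "integrable \<mu> focal_volume" by (rule integrable_area[OF continuous_focal_volume])
qed

lemma inner_volume_eq:
  "inner_volume P f \<nu> \<Omega> u = measure lebesgue \<Omega> +
    (\<integral>x. - u x + E1 P f \<nu> x * (u x)\<^sup>2 - \<kappa>\<^sub>1 x * \<kappa>\<^sub>2 x / 3 * u x ^ 3 \<partial>\<mu>)"
  unfolding inner_volume_def oriented_volume_def interval_integral_quadratic
  by (simp add: E1_def power3_eq_cube power2_eq_square)

text \<open>The cubic polynomial at depth \<open>1 / \<kappa>\<^sub>1\<close> is minus the
  integrated Jacobian, so \<open>volume_le\<close> says precisely that this oriented volume is
  nonpositive.\<close>

lemma inner_volume_lambda1:
  "inner_volume P f \<nu> \<Omega> (\<lambda>x. 1 / \<kappa>\<^sub>1 x) = measure lebesgue \<Omega> - (\<integral>x. focal_volume x \<partial>\<mu>)"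
proof -
  have "- (1 / \<kappa>\<^sub>1 x) + E1 P f \<nu> x * (1 / \<kappa>\<^sub>1 x)\<^sup>2 - \<kappa>\<^sub>1 x * \<kappa>\<^sub>2 x / 3 * (1 / \<kappa>\<^sub>1 x) ^ 3 = - focal_volume x"
    for x
    using lambda1_pos[of x]
    by (simp add: E1_def focal_volume_def power2_eq_square power3_eq_cube field_simps)
  then show ?thesis unfolding inner_volume_eq by simp
qed

text \<open>At u = 1 / \<open>E1\<close> the linear and quadratic terms cancel. In the cubic term
  the Gauss curvature is the square of \<open>E1\<close> minus half the squared trace-free
  norm.\<close>

lemma inner_volume_E1:
  "inner_volume P f \<nu> \<Omega> (\<lambda>x. 1 / E1 P f \<nu> x) = measure lebesgue \<Omega> -
    (1/3 * (\<integral>x. 1 / E1 P f \<nu> x \<partial>\<mu>) -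
     1/6 * (\<integral>x. tracefree_norm_sq P f \<nu> x / (E1 P f \<nu> x) ^ 3 \<partial>\<mu>))"
proof -
  have "- (1 / E1 P f \<nu> x) + E1 P f \<nu> x * (1 / E1 P f \<nu> x)\<^sup>2 - \<kappa>\<^sub>1 x * \<kappa>\<^sub>2 x / 3 * (1 / E1 P f \<nu> x) ^ 3 =
      - (1/3 * (1 / E1 P f \<nu> x) - 1/6 * (tracefree_norm_sq P f \<nu> x / (E1 P f \<nu> x) ^ 3))" for x
  proof -
    define e where "e = E1 P f \<nu> x"
    have e: "e \<noteq> 0" using E1_pos[of x] by (simp add: e_def)
    have k: "\<kappa>\<^sub>1 x * \<kappa>\<^sub>2 x = e\<^sup>2 - tracefree_norm_sq P f \<nu> x / 2"
      by (simp add: e_def E1_def tracefree_norm_sq_eq power2_eq_square field_simps)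
    show ?thesis unfolding k e_def[symmetric] using e
      by (simp add: power2_eq_square power3_eq_cube field_simps)
  qed
  then show ?thesis
    by (simp only: inner_volume_eq Bochner_Integration.integral_diff integrable_mult_right
        integrable_terms integral_mult_right_zero Bochner_Integration.integral_minus add_uminus_conv_diff)
qed

text \<open>With a = \<open>\<kappa>\<^sub>1 x\<close> and s =
  \<open>\<kappa>\<^sub>1 x + \<kappa>\<^sub>2 x\<close>, the difference 2 / (3 s) - (4 a - s) / (6
  a^2) is the perfect square (2 a - s)^2 divided by 6 a^2 s, and 2 a - s is the gap between the
  curvatures.\<close>

lemma integral_E1_split:
  "1/3 * (\<integral>x. 1 / E1 P f \<nu> x \<partial>\<mu>) = (\<integral>x. focal_volume x \<partial>\<mu>) +
    1/6 * (\<integral>x. tracefree_norm_sq P f \<nu> x / ((\<kappa>\<^sub>1 x)\<^sup>2 * E1 P f \<nu> x) \<partial>\<mu>)"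
proof -
  have "1/3 * (1 / E1 P f \<nu> x) =
      focal_volume x + 1/6 * (tracefree_norm_sq P f \<nu> x / ((\<kappa>\<^sub>1 x)\<^sup>2 * E1 P f \<nu> x))" for x
  proof -
    define a s where "a = \<kappa>\<^sub>1 x" and "s = \<kappa>\<^sub>1 x + \<kappa>\<^sub>2 x"
    have as: "a \<noteq> 0" "s \<noteq> 0" using lambda1_pos[of x] E1_pos[of x] by (simp_all add: a_def s_def E1_def)
    have k: "\<kappa>\<^sub>1 x = a" "\<kappa>\<^sub>2 x = s - a" by (simp_all add: a_def s_def)
    show ?thesis
      unfolding tracefree_norm_sq_eq focal_volume_def E1_def k using as
      by (simp add: power2_eq_square field_simps)
  qed
  then have "(\<integral>x. 1/3 * (1 / E1 P f \<nu> x) \<partial>\<mu>) =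
      (\<integral>x. focal_volume x + 1/6 * (tracefree_norm_sq P f \<nu> x / ((\<kappa>\<^sub>1 x)\<^sup>2 * E1 P f \<nu> x)) \<partial>\<mu>)"
    by (simp only:)
  then show ?thesis
    by (simp only: Bochner_Integration.integral_add integrable_mult_right integrable_terms
        integral_mult_right_zero)
qed

end

theorem theorem24:
  fixes P :: "'m::t2_space atlas"
    and f \<nu> :: "'m \<Rightarrow> real^3"
    and \<Omega> :: "(real^3) set"
  assumes "closed_surface P"
    and "smooth_embedding P f"
    and "encloses f \<Omega>"
    and "outward_unit_normal P f \<Omega> \<nu>"
    and "mean_convex P f \<nu>"
  shows "1/3 * (\<integral>x. 1 / E1 P f \<nu> x \<partial>area_measure P f) - measure lebesgue \<Omega> =
           \<bar>inner_volume P f \<nu> \<Omega> (\<lambda>x. 1 / lambda1 P f \<nu> x)\<bar> +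
           1/6 * (\<integral>x. tracefree_norm_sq P f \<nu> x / ((lambda1 P f \<nu> x)\<^sup>2 * E1 P f \<nu> x)
                    \<partial>area_measure P f)
       \<and> \<bar>inner_volume P f \<nu> \<Omega> (\<lambda>x. 1 / lambda1 P f \<nu> x)\<bar> +
           1/6 * (\<integral>x. tracefree_norm_sq P f \<nu> x / ((lambda1 P f \<nu> x)\<^sup>2 * E1 P f \<nu> x)
                    \<partial>area_measure P f) =
         - inner_volume P f \<nu> \<Omega> (\<lambda>x. 1 / E1 P f \<nu> x) +
           1/6 * (\<integral>x. tracefree_norm_sq P f \<nu> x / (E1 P f \<nu> x)^3 \<partial>area_measure P f)"
proof -
  interpret enclosing_surface P f \<nu> \<Omega> by (rule enclosing_surface.intro[OF assms])
  \<comment> \<open>The volume inequality enters here, to resolve the absolute value; both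
    equalities are then linear in the integrals.\<close>
  have "\<bar>inner_volume P f \<nu> \<Omega> (\<lambda>x. 1 / \<kappa>\<^sub>1 x)\<bar> = (\<integral>x. focal_volume x \<partial>\<mu>) - measure lebesgue \<Omega>"
    using volume_le unfolding inner_volume_lambda1 by linarith
  then show ?thesis unfolding inner_volume_E1 using integral_E1_split by linarith
qed

end
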